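(* Let $\phi\in L^2(\mathbb R)$ and let $V_0^{\mathbf M}$ be the closed linear span in $L^2(\mathbb R)$ of $\{\phi^{\mathbf M}_{0,k}:k\in\mathbb Z\}$. Then the collection $\{\phi^{\mathbf M}_{0,k}(t):k\in\mathbb Z\}$ is a Riesz basis of the space $V_0^{\mathbf M}$ if and only if there exist positive constants $A_1$ and $A_2$ such that for almost all $\omega\in[0,2\pi B]$, $$A_1\le\sum_{k\in\mathbb Z}\left|\widehat\phi\left(\frac{\omega-p}{B}+2k\pi\right)\right|^2\le A_2.$$
   Context: Fix real numbers $A,B,C,D,p,q$ with $AD-BC=1$ and $B\neq0$, and write $\mathbf M=(A,B,C,D:p,q)$. (If $B<0$, $[0,2\pi B]$ denotes the interval with endpoints $0$ and $2\pi B$.) For $\phi\in L^2(\mathbb R)$ and $k\in\mathbb Z$, $$\phi^{\mathbf M}_{0,k}(t)=\phi(t-k)\exp\left\{-\frac{i}{2B}\left(At^2+Dp^2-Ak^2\right)\right\}.$$ The Fourier transform is normalized as $\widehat\phi(\xi)=\int_{\mathbb R}\phi(t)e^{-i\xi t}\,dt$ (extended to $L^2(\mathbb R)$). *)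

theory Defs
  imports "HOL-Analysis.Analysis"
begin

text \<open>
  Elements of \<open>L\<^sup>2(\<real>)\<close> are represented by Lebesgue measurable, square integrable functions;
  nothing is quotiented, so \<open>L2_norm\<close> is a seminorm. Every notion below depends on its
  function arguments only up to equality almost everywhere.
\<close>

definition L2 :: "(real \<Rightarrow> complex) set" where
  "L2 = {f \<in> borel_measurable lebesgue. integrable lebesgue (\<lambda>t. (cmod (f t))\<^sup>2)}"

definition L2_norm :: "(real \<Rightarrow> complex) \<Rightarrow> real" where
  "L2_norm f = sqrt (LINT t|lebesgue. (cmod (f t))\<^sup>2)"

definition fourier_L1 :: "(real \<Rightarrow> complex) \<Rightarrow> real \<Rightarrow> complex" where
  "fourier_L1 f \<xi> = (LINT t|lebesgue. f t * exp (- \<i> * complex_of_real (t * \<xi>)))"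

text \<open>
  The continuous extension of \<open>fourier_L1\<close> from the dense subspace \<open>L\<^sup>1 \<inter> L\<^sup>2\<close> to \<open>L\<^sup>2\<close>.
  By Plancherel's theorem such a \<open>g\<close> exists for every \<open>f \<in> L2\<close>, and it is unique almost
  everywhere because \<open>f\<close> is the limit of its truncations to bounded intervals.
\<close>

definition fourier_L2 :: "(real \<Rightarrow> complex) \<Rightarrow> real \<Rightarrow> complex" where
  "fourier_L2 f = (SOME g. g \<in> L2 \<and>
     (\<forall>h :: nat \<Rightarrow> real \<Rightarrow> complex.
        (\<forall>n. integrable lebesgue (h n) \<and> h n \<in> L2) \<and>
        (\<lambda>n. L2_norm (\<lambda>t. h n t - f t)) \<longlonglongrightarrow> 0 \<longrightarrow>
        (\<lambda>n. L2_norm (\<lambda>\<xi>. fourier_L1 (h n) \<xi> - g \<xi>)) \<longlonglongrightarrow> 0))"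

definition L2_closed_span :: "('i \<Rightarrow> real \<Rightarrow> complex) \<Rightarrow> (real \<Rightarrow> complex) set" where
  "L2_closed_span x = {f \<in> L2. \<forall>\<epsilon>>0. \<exists>F c. finite F \<and>
     L2_norm (\<lambda>t. f t - (\<Sum>k\<in>F. c k * x k t)) < \<epsilon>}"

text \<open>Unconditional convergence of a series in the \<open>L\<^sup>2\<close> norm.\<close>

definition has_L2_sum :: "('i \<Rightarrow> real \<Rightarrow> complex) \<Rightarrow> (real \<Rightarrow> complex) \<Rightarrow> bool" where
  "has_L2_sum x f \<longleftrightarrow> f \<in> L2 \<and>
     ((\<lambda>F. L2_norm (\<lambda>t. (\<Sum>k\<in>F. x k t) - f t)) \<longlongrightarrow> 0) (finite_subsets_at_top UNIV)"

text \<open>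
  The definition usual in wavelet theory: \<open>x\<close> is complete in \<open>V\<close>, and for every
  \<open>c \<in> \<ell>\<^sup>2\<close> the series \<open>\<Sum>k. c k * x k\<close> converges and its squared norm is
  comparable to that of \<open>c\<close>, with constants independent of \<open>c\<close>.
\<close>

definition riesz_basis :: "('i \<Rightarrow> real \<Rightarrow> complex) \<Rightarrow> (real \<Rightarrow> complex) set \<Rightarrow> bool" where
  "riesz_basis x V \<longleftrightarrow> (\<forall>k. x k \<in> L2) \<and> L2_closed_span x = V \<and>
     (\<exists>a b :: real. a > 0 \<and> b > 0 \<and>
        (\<forall>c :: 'i \<Rightarrow> complex. (\<lambda>k. (cmod (c k))\<^sup>2) summable_on UNIV \<longrightarrow>
           (\<exists>f. has_L2_sum (\<lambda>k t. c k * x k t) f \<and>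
              a * (\<Sum>\<^sub>\<infinity>k. (cmod (c k))\<^sup>2) \<le> (L2_norm f)\<^sup>2 \<and>
              (L2_norm f)\<^sup>2 \<le> b * (\<Sum>\<^sub>\<infinity>k. (cmod (c k))\<^sup>2))))"

text \<open>
  \<open>\<phi>\<^sup>M\<^sub>0\<^sub>,\<^sub>k\<close> for \<open>M = (A, B, C, D : p, q)\<close>. The formula does not involve \<open>C\<close> and \<open>q\<close>.
\<close>

definition phi_M :: "real \<Rightarrow> real \<Rightarrow> real \<Rightarrow> real \<Rightarrow> real \<Rightarrow> real \<Rightarrow>
    (real \<Rightarrow> complex) \<Rightarrow> int \<Rightarrow> real \<Rightarrow> complex" where
  "phi_M A B C D p q \<phi> k t =
     \<phi> (t - of_int k) *
     exp (- (\<i> / complex_of_real (2 * B)) *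
          complex_of_real (A * t\<^sup>2 + D * p\<^sup>2 - A * (of_int k)\<^sup>2))"

end

theory Submission
  imports Defs "HOL-Probability.Characteristic_Functions"
begin

text \<open>
The exponential in \<open>\<phi>\<^sup>M\<^sub>0\<^sub>,\<^sub>k(t)\<close> splits into a factor of modulus one depending on \<open>t\<close> only and a
factor of modulus one depending on \<open>k\<close> only. The former does not change \<open>L\<^sup>2\<close> norms and the latter can
be absorbed into the coefficients, so the Riesz bounds of the family \<open>\<phi>\<^sup>M\<^sub>0\<^sub>,\<^sub>k\<close> are those of the integer
translates \<open>\<phi>(t - k)\<close>. Completeness in \<open>V\<^sub>0\<close> holds by the choice of \<open>V\<^sub>0\<close>, and since \<open>L\<^sup>2\<close> is complete
(\<open>L2_complete\<close>) the Riesz bounds need only be known for finite sums (\<open>riesz_basis_closed_span_iff\<close>).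

Let \<open>G(\<xi>) = \<Sum>k. \<bar>\<phi>^(\<xi> + 2k\<pi>)\<bar>\<^sup>2\<close>. Translation becomes modulation under the Fourier transform, so by Plancherel
and by cutting the line into intervals of length \<open>2\<pi>\<close>, a finite sum of translates with coefficients \<open>d\<close>
satisfies
\<open>2\<pi> \<parallel>\<Sum>k. d k * \<phi>(t - k)\<parallel>\<^sup>2 = \<integral>\<^sub>[\<^sub>0\<^sub>,\<^sub>2\<^sub>\<pi>\<^sub>] \<bar>P\<bar>\<^sup>2 G\<close> with \<open>P(\<xi>) = \<Sum>k. d k * exp(-ik\<xi>)\<close>,
while \<open>2\<pi> \<Sum>k. \<bar>d k\<bar>\<^sup>2 = \<integral>\<^sub>[\<^sub>0\<^sub>,\<^sub>2\<^sub>\<pi>\<^sub>] \<bar>P\<bar>\<^sup>2\<close>. Bounds on \<open>G\<close> therefore give the Riesz bounds at once. Conversely,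
the Riesz bounds say that \<open>G - a\<close> and \<open>b - G\<close> have nonnegative integral against every \<open>\<bar>P\<bar>\<^sup>2\<close>; by
Stone-Weierstrass on the circle these squares are rich enough to force both functions to be nonnegative
almost everywhere (\<open>AE_nonneg_if_trig_poly_integrals_nonneg\<close>). Both directions keep the constants
(\<open>shift_sum_bounds_iff_periodization_bounds\<close>). Finally \<open>\<omega> \<mapsto> (\<omega> - p)/B\<close> maps the segment from \<open>0\<close> to
\<open>2\<pi>B\<close> onto a full period of \<open>G\<close>.

Plancherel's theorem (\<open>plancherel\<close>) is proved by Gaussian regularization of the integral of \<open>\<bar>h^\<bar>\<^sup>2\<close>. It is
needed also to make sense of \<open>fourier_L2\<close>, which is the extension by continuity of an isometry up to the
factor \<open>sqrt(2\<pi>)\<close> (\<open>fourier_L2_exists\<close>).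
\<close>

section \<open>The \<open>L\<^sup>2\<close> seminorm\<close>

lemma L2_borel: "f \<in> L2 \<Longrightarrow> f \<in> borel_measurable lebesgue"
  by (simp add: L2_def)

lemma L2_integrable_sq: "f \<in> L2 \<Longrightarrow> integrable lebesgue (\<lambda>t. (cmod (f t))\<^sup>2)"
  by (simp add: L2_def)

lemma L2_norm_nonneg: "0 \<le> L2_norm f"
  by (simp add: L2_norm_def)

lemma L2_norm_sq: "(L2_norm f)\<^sup>2 = (LINT t|lebesgue. (cmod (f t))\<^sup>2)"
  by (simp add: L2_norm_def)

lemma L2_nn_integral:
  assumes "f \<in> L2"
  shows "(\<integral>\<^sup>+t. ennreal ((cmod (f t))\<^sup>2) \<partial>lebesgue) = ennreal ((L2_norm f)\<^sup>2)"
  unfolding L2_norm_sq by (rule nn_integral_eq_integral[OF L2_integrable_sq[OF assms]]) auto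

lemma L2I_nn_integral:
  assumes "f \<in> borel_measurable lebesgue"
    and "(\<integral>\<^sup>+t. ennreal ((cmod (f t))\<^sup>2) \<partial>lebesgue) \<le> ennreal r"
  shows "f \<in> L2"
proof -
  have "(\<lambda>t. (cmod (f t))\<^sup>2) \<in> borel_measurable lebesgue"
    using assms(1) by measurable
  moreover have "(\<integral>\<^sup>+t. ennreal (norm ((cmod (f t))\<^sup>2)) \<partial>lebesgue) < \<infinity>"
    using le_less_trans[OF assms(2) ennreal_less_top] by simp
  ultimately show ?thesis
    using assms(1) by (simp add: L2_def integrable_iff_bounded)
qed

lemma L2_norm_le_nn_integral:
  assumes "f \<in> borel_measurable lebesgue" "0 \<le> r"
    and "(\<integral>\<^sup>+t. ennreal ((cmod (f t))\<^sup>2) \<partial>lebesgue) \<le> ennreal (r\<^sup>2)"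
  shows "L2_norm f \<le> r"
proof -
  have "ennreal ((L2_norm f)\<^sup>2) \<le> ennreal (r\<^sup>2)"
    using assms(3) L2_nn_integral[OF L2I_nn_integral[OF assms(1,3)]] by simp
  then show ?thesis
    using assms(2) by (simp add: power2_le_iff_abs_le L2_norm_nonneg)
qed

lemma L2_cong_AE:
  assumes "f \<in> L2" "g \<in> borel_measurable lebesgue" "AE t in lebesgue. f t = g t"
  shows "g \<in> L2"
proof -
  have "(\<integral>\<^sup>+t. ennreal ((cmod (g t))\<^sup>2) \<partial>lebesgue) = (\<integral>\<^sup>+t. ennreal ((cmod (f t))\<^sup>2) \<partial>lebesgue)"
    using assms(3) by (intro nn_integral_cong_AE) auto
  then show ?thesis
    using L2I_nn_integral[OF assms(2), of "(L2_norm f)\<^sup>2"] L2_nn_integral[OF assms(1)] by simp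
qed

lemma L2_norm_cong_AE:
  assumes "f \<in> borel_measurable lebesgue" "g \<in> borel_measurable lebesgue" "AE t in lebesgue. f t = g t"
  shows "L2_norm f = L2_norm g"
proof -
  have "(LINT t|lebesgue. (cmod (f t))\<^sup>2) = (LINT t|lebesgue. (cmod (g t))\<^sup>2)"
    using assms by (intro integral_cong_AE) auto
  then show ?thesis by (simp add: L2_norm_def)
qed

lemma L2_dominated:
  assumes "f \<in> L2" "g \<in> borel_measurable lebesgue" "\<And>t. cmod (g t) \<le> M * cmod (f t)"
  shows "g \<in> L2"
proof -
  have "integrable lebesgue (\<lambda>t. M\<^sup>2 * (cmod (f t))\<^sup>2)"
    using L2_integrable_sq[OF assms(1)] by simp
  then have "integrable lebesgue (\<lambda>t. (cmod (g t))\<^sup>2)"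
  proof (rule Bochner_Integration.integrable_bound)
    show "(\<lambda>t. (cmod (g t))\<^sup>2) \<in> borel_measurable lebesgue"
      using assms(2) by measurable
    show "AE t in lebesgue. norm ((cmod (g t))\<^sup>2) \<le> norm (M\<^sup>2 * (cmod (f t))\<^sup>2)"
      using power_mono[OF assms(3), of _ 2] by (auto simp: power_mult_distrib)
  qed
  then show ?thesis using assms(2) by (simp add: L2_def)
qed

lemma L2_norm_mult_bound:
  assumes "f \<in> L2" "g \<in> borel_measurable lebesgue" "\<And>t. cmod (g t) \<le> M * cmod (f t)" "0 \<le> M"
  shows "L2_norm g \<le> M * L2_norm f"
proof (rule power2_le_imp_le)
  have "(L2_norm g)\<^sup>2 \<le> (LINT t|lebesgue. M\<^sup>2 * (cmod (f t))\<^sup>2)"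
    unfolding L2_norm_sq
    using L2_integrable_sq[OF L2_dominated[OF assms(1-3)]] L2_integrable_sq[OF assms(1)]
      power_mono[OF assms(3), of _ 2]
    by (intro integral_mono) (auto simp: power_mult_distrib)
  also have "\<dots> = (M * L2_norm f)\<^sup>2"
    by (simp add: L2_norm_sq power_mult_distrib)
  finally show "(L2_norm g)\<^sup>2 \<le> (M * L2_norm f)\<^sup>2" .
qed (use assms(4) in \<open>simp add: L2_norm_nonneg\<close>)

lemma L2_zero [simp]: "(\<lambda>t. 0) \<in> L2" and L2_norm_zero [simp]: "L2_norm (\<lambda>t. 0) = 0"
  by (simp_all add: L2_def L2_norm_def)

lemma L2_cmult [intro]: "f \<in> L2 \<Longrightarrow> (\<lambda>t. c * f t) \<in> L2"
  by (rule L2_dominated[of f _ "cmod c"]) (auto simp: norm_mult dest: L2_borel)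

lemma L2_norm_cmult: "L2_norm (\<lambda>t. c * f t) = cmod c * L2_norm f"
  by (simp add: L2_norm_def norm_mult power_mult_distrib real_sqrt_mult)

text \<open>
A triangle inequality for squares with a free weight. It integrates termwise, and optimizing the weight
afterwards yields Minkowski's inequality without the Cauchy-Schwarz inequality.
\<close>

lemma norm_add_sq_weighted:
  fixes x y :: complex
  assumes "s > 0"
  shows "(cmod (x + y))\<^sup>2 \<le> (1 + s) * (cmod x)\<^sup>2 + (1 + 1 / s) * (cmod y)\<^sup>2"
proof -
  let ?a = "cmod x" and ?b = "cmod y"
  have "(cmod (x + y))\<^sup>2 \<le> (?a + ?b)\<^sup>2"
    by (intro power_mono norm_triangle_ineq) auto
  moreover have "0 \<le> (s * ?a - ?b)\<^sup>2 / s"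
    using assms by simp
  moreover have "(s * ?a - ?b)\<^sup>2 / s = s * ?a\<^sup>2 - 2 * ?a * ?b + ?b\<^sup>2 / s"
    using assms by (simp add: field_simps power2_eq_square)
  ultimately show ?thesis by (simp add: power2_sum algebra_simps)
qed

lemma L2_add [intro]:
  assumes "f \<in> L2" "g \<in> L2"
  shows "(\<lambda>t. f t + g t) \<in> L2"
proof -
  have m: "(\<lambda>t. f t + g t) \<in> borel_measurable lebesgue"
    using assms by (intro borel_measurable_add L2_borel)
  have "integrable lebesgue (\<lambda>t. 2 * (cmod (f t))\<^sup>2 + 2 * (cmod (g t))\<^sup>2)"
    using assms by (intro Bochner_Integration.integrable_add integrable_mult_right L2_integrable_sq)
  then have "integrable lebesgue (\<lambda>t. (cmod (f t + g t))\<^sup>2)"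
    using m norm_add_sq_weighted[of 1]
    by (rule_tac Bochner_Integration.integrable_bound) auto
  then show ?thesis using m by (simp add: L2_def)
qed

lemma L2_diff [intro]: "f \<in> L2 \<Longrightarrow> g \<in> L2 \<Longrightarrow> (\<lambda>t. f t - g t) \<in> L2"
  using L2_add[of f "\<lambda>t. - 1 * g t"] L2_cmult[of g "-1"] by simp

lemma L2_sum: "(\<And>k. k \<in> F \<Longrightarrow> x k \<in> L2) \<Longrightarrow> (\<lambda>t. \<Sum>k\<in>F. x k t) \<in> L2"
  by (induction F rule: infinite_finite_induct) (auto intro: L2_add)

lemma L2_norm_triangle:
  assumes "f \<in> L2" "g \<in> L2"
  shows "L2_norm (\<lambda>t. f t + g t) \<le> L2_norm f + L2_norm g"
proof -
  let ?a = "L2_norm f" and ?b = "L2_norm g"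
  have w: "(L2_norm (\<lambda>t. f t + g t))\<^sup>2 \<le> (1 + s) * ?a\<^sup>2 + (1 + 1 / s) * ?b\<^sup>2" if "s > 0" for s
  proof -
    have "(L2_norm (\<lambda>t. f t + g t))\<^sup>2
      \<le> (LINT t|lebesgue. (1 + s) * (cmod (f t))\<^sup>2 + (1 + 1 / s) * (cmod (g t))\<^sup>2)"
      unfolding L2_norm_sq using assms that norm_add_sq_weighted[OF that] L2_integrable_sq[OF L2_add[OF assms]]
      by (intro integral_mono Bochner_Integration.integrable_add integrable_mult_right)
        (auto dest: L2_integrable_sq)
    also have "\<dots> = (1 + s) * ?a\<^sup>2 + (1 + 1 / s) * ?b\<^sup>2"
      using assms unfolding L2_norm_sq
      by (subst Bochner_Integration.integral_add)
        (auto dest: L2_integrable_sq intro!: integrable_mult_right)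
    finally show ?thesis .
  qed
  \<comment> \<open>The optimal weight is \<open>\<parallel>g\<parallel> / \<parallel>f\<parallel>\<close>; adding \<open>e\<close> to both norms avoids division by zero.\<close>
  have "L2_norm (\<lambda>t. f t + g t) \<le> ?a + ?b + 2 * e" if "e > 0" for e
  proof (rule power2_le_imp_le)
    let ?A = "?a + e" and ?B = "?b + e"
    have pos: "?A > 0" "?B > 0" using that L2_norm_nonneg[of f] L2_norm_nonneg[of g] by auto
    have "(L2_norm (\<lambda>t. f t + g t))\<^sup>2 \<le> (1 + ?B/?A) * ?a\<^sup>2 + (1 + 1 / (?B/?A)) * ?b\<^sup>2"
      by (rule w) (use pos in simp)
    also have "\<dots> \<le> (1 + ?B/?A) * ?A\<^sup>2 + (1 + 1 / (?B/?A)) * ?B\<^sup>2"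
      using pos that L2_norm_nonneg[of f] L2_norm_nonneg[of g]
      by (intro add_mono mult_left_mono power_mono) auto
    also have "\<dots> = (?a + ?b + 2 * e)\<^sup>2"
    proof -
      have "(1 + Y/X) * X\<^sup>2 + (1 + 1 / (Y/X)) * Y\<^sup>2 = (X + Y)\<^sup>2" if "X > 0" "Y > 0" for X Y :: real
        using that by (simp add: field_simps power2_eq_square)
      from this[OF pos] show ?thesis by (simp add: algebra_simps)
    qed
    finally show "(L2_norm (\<lambda>t. f t + g t))\<^sup>2 \<le> (?a + ?b + 2 * e)\<^sup>2" .
  qed (use that L2_norm_nonneg[of f] L2_norm_nonneg[of g] in simp)
  then have "L2_norm (\<lambda>t. f t + g t) \<le> ?a + ?b + e" if "e > 0" for e
    using that by (metis field_sum_of_halves half_gt_zero mult_2)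
  then show ?thesis by (rule field_le_epsilon)
qed

lemma L2_norm_minus_commute: "L2_norm (\<lambda>t. f t - g t) = L2_norm (\<lambda>t. g t - f t)"
  by (simp add: L2_norm_def norm_minus_commute)

lemma L2_norm_triangle_diff:
  assumes "f \<in> L2" "g \<in> L2" "h \<in> L2"
  shows "L2_norm (\<lambda>t. f t - h t) \<le> L2_norm (\<lambda>t. f t - g t) + L2_norm (\<lambda>t. g t - h t)"
  using L2_norm_triangle[OF L2_diff[OF assms(1,2)] L2_diff[OF assms(2,3)]] by simp

lemma L2_norm_diff_ge:
  assumes "f \<in> L2" "g \<in> L2"
  shows "\<bar>L2_norm f - L2_norm g\<bar> \<le> L2_norm (\<lambda>t. f t - g t)"
  using L2_norm_triangle[OF assms(2) L2_diff[OF assms(1,2)]]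
    L2_norm_triangle[OF assms(1) L2_diff[OF assms(2,1)]]
  by (simp add: L2_norm_minus_commute[of f g])

lemma L2_norm_tendsto:
  assumes "f \<in> L2" "\<And>n. g n \<in> L2" "((\<lambda>n. L2_norm (\<lambda>t. g n t - f t)) \<longlongrightarrow> 0) F"
  shows "((\<lambda>n. L2_norm (g n)) \<longlongrightarrow> L2_norm f) F"
proof -
  have "((\<lambda>n. L2_norm (g n) - L2_norm f) \<longlongrightarrow> 0) F"
    by (rule Lim_null_comparison[OF _ assms(3)])
      (auto intro!: always_eventually L2_norm_diff_ge assms(1,2))
  then show ?thesis by (simp add: LIM_zero_iff)
qed

text \<open>
Fubini's theorem and affine substitution concern Borel functions on \<open>lborel\<close>, whereas elements of \<open>L2\<close>
are only Lebesgue measurable; changing them on a null set bridges the gap.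
\<close>

lemma L2_borel_representative:
  assumes "f \<in> borel_measurable lebesgue"
  obtains g :: "real \<Rightarrow> complex" where "g \<in> borel_measurable borel" "AE t in lebesgue. f t = g t"
proof -
  have "(\<lambda>t. Re (f t)) \<in> borel_measurable lebesgue" "(\<lambda>t. Im (f t)) \<in> borel_measurable lebesgue"
    using assms by measurable
  then obtain u v where "u \<in> borel_measurable lborel" "AE t in lborel. Re (f t) = u t"
      "v \<in> borel_measurable lborel" "AE t in lborel. Im (f t) = v t"
    by (metis completion_ex_borel_measurable_real)
  then show ?thesis
    by (intro that[of "\<lambda>t. Complex (u t) (v t)"])
      (auto simp: AE_completion_iff Complex_eq intro!: borel_measurable_add elim!: AE_mp simp: complex_eq_iff)
qed

lemma lebesgue_measurable_affine:
  assumes "f \<in> borel_measurable lebesgue" "c \<noteq> (0::real)"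
  shows "(\<lambda>x. f (t + c * x)) \<in> borel_measurable lebesgue"
  using measurable_compose[OF lebesgue_affine_measurable[where c="\<lambda>_::real. c" and t=t] assms(1)] assms(2)
  by (simp add: o_def)

lemma L2_shift:
  assumes "f \<in> L2"
  shows "(\<lambda>t. f (t - s)) \<in> L2" and "L2_norm (\<lambda>t. f (t - s)) = L2_norm f"
proof -
  have m: "(\<lambda>t. f (t - s)) \<in> borel_measurable lebesgue"
    using lebesgue_measurable_affine[OF L2_borel[OF assms], of 1 "-s"] by simp
  have "(\<integral>\<^sup>+t. ennreal ((cmod (f t))\<^sup>2) \<partial>lebesgue) = (\<integral>\<^sup>+t. ennreal ((cmod (f (t - s)))\<^sup>2) \<partial>lebesgue)"
    using nn_integral_real_affine_lebesgue[of "\<lambda>t. ennreal ((cmod (f t))\<^sup>2)" 1 "-s"] L2_borel[OF assms]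
    by simp
  then have e: "(\<integral>\<^sup>+t. ennreal ((cmod (f (t - s)))\<^sup>2) \<partial>lebesgue) = ennreal ((L2_norm f)\<^sup>2)"
    using L2_nn_integral[OF assms] by simp
  then show 1: "(\<lambda>t. f (t - s)) \<in> L2" using L2I_nn_integral[OF m, of "(L2_norm f)\<^sup>2"] by simp
  show "L2_norm (\<lambda>t. f (t - s)) = L2_norm f"
    using e L2_nn_integral[OF 1] by (simp add: L2_norm_nonneg)
qed

section \<open>Completeness and density in \<open>L\<^sup>2\<close>\<close>

lemma L2_dominated_convergence:
  fixes s :: "nat \<Rightarrow> real \<Rightarrow> complex"
  assumes f: "f \<in> borel_measurable lebesgue" and s: "\<And>n. s n \<in> borel_measurable lebesgue"
    and w: "w \<in> L2"
    and bd: "\<And>n. AE t in lebesgue. cmod (s n t) \<le> cmod (w t)"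
    and lim: "AE t in lebesgue. (\<lambda>n. s n t) \<longlonglongrightarrow> f t"
  shows "(\<lambda>n. L2_norm (\<lambda>t. s n t - f t)) \<longlonglongrightarrow> 0"
proof -
  have bd': "AE t in lebesgue. \<forall>n. cmod (s n t) \<le> cmod (w t)"
    using bd by (simp add: AE_all_countable)
  have fb: "AE t in lebesgue. cmod (f t) \<le> cmod (w t)"
    using lim bd'
  proof eventually_elim
    case (elim t)
    then show ?case by (intro Lim_bounded[OF tendsto_norm]) auto
  qed
  have "(\<lambda>n. LINT t|lebesgue. (cmod (s n t - f t))\<^sup>2) \<longlonglongrightarrow> (LINT t|(lebesgue::real measure). (0::real))"
  proof (rule integral_dominated_convergence[where w="\<lambda>t. 4 * (cmod (w t))\<^sup>2"])
    show "integrable lebesgue (\<lambda>t. 4 * (cmod (w t))\<^sup>2)"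
      using L2_integrable_sq[OF w] by simp
    show "AE t in lebesgue. (\<lambda>n. (cmod (s n t - f t))\<^sup>2) \<longlonglongrightarrow> 0"
      using lim
    proof eventually_elim
      case (elim t)
      then have "(\<lambda>n. (cmod (s n t - f t))\<^sup>2) \<longlonglongrightarrow> (cmod (f t - f t))\<^sup>2"
        by (intro tendsto_intros)
      then show ?case by simp
    qed
    show "AE t in lebesgue. norm ((cmod (s n t - f t))\<^sup>2) \<le> 4 * (cmod (w t))\<^sup>2" for n
      using fb bd[of n]
    proof eventually_elim
      case (elim t)
      have "(cmod (s n t - f t))\<^sup>2 \<le> (2 * cmod (w t))\<^sup>2"
        using elim norm_triangle_ineq4[of "s n t" "f t"] by (intro power_mono) auto
      then show ?case by (simp add: power_mult_distrib)
    qed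
  qed (use f s in measurable)
  then have "(\<lambda>n. sqrt (LINT t|lebesgue. (cmod (s n t - f t))\<^sup>2)) \<longlonglongrightarrow> sqrt 0"
    by (intro tendsto_intros) simp
  then show ?thesis by (simp add: L2_norm_def)
qed

text \<open>
The Riesz-Fischer theorem. A subsequence with increments \<open>d k\<close> of norm at most \<open>4^-k\<close> converges almost
everywhere: the integral of \<open>\<Sum>k. 4^k \<bar>d k\<bar>\<^sup>2\<close> is finite, so almost everywhere \<open>\<bar>d k\<bar>\<close> is dominated by a
geometric sequence. Fatou's lemma shows that the pointwise limit is also the limit in norm of the whole
sequence.
\<close>

theorem L2_complete:
  assumes f: "\<And>n. f n \<in> L2"
    and Cauchy: "\<And>e. e > 0 \<Longrightarrow> \<exists>N. \<forall>m\<ge>N. \<forall>n\<ge>N. L2_norm (\<lambda>t. f m t - f n t) < e"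
  obtains g where "g \<in> L2" "(\<lambda>n. L2_norm (\<lambda>t. f n t - g t)) \<longlonglongrightarrow> 0"
proof -
  have "\<exists>N. \<forall>m\<ge>N. \<forall>n\<ge>N. L2_norm (\<lambda>t. f m t - f n t) < (1/4)^k" for k :: nat
    by (rule Cauchy) simp
  then obtain N where N: "L2_norm (\<lambda>t. f m t - f n t) < (1/4)^k" if "m \<ge> N k" "n \<ge> N k" for k m n
    by metis
  \<comment> \<open>Partial sums make the chosen indices monotone while staying above every \<open>N j\<close>.\<close>
  define r where "r k = (\<Sum>j\<le>k. N j)" for k :: nat
  have rN: "N k \<le> r j" if "k \<le> j" for k j
    unfolding r_def using that by (intro member_le_sum) auto
  define d where "d k t = f (r (Suc k)) t - f (r k) t" for k t
  have dL2: "d k \<in> L2" for k unfolding d_def by (intro L2_diff f)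
  have dm: "d k \<in> borel_measurable lebesgue" for k using dL2 by (rule L2_borel)
  have "(\<integral>\<^sup>+t. (\<Sum>k. ennreal (4^k * (cmod (d k t))\<^sup>2)) \<partial>lebesgue)
      = (\<Sum>k. \<integral>\<^sup>+t. ennreal (4^k * (cmod (d k t))\<^sup>2) \<partial>lebesgue)"
    using dm by (intro nn_integral_suminf) measurable
  also have "\<dots> = (\<Sum>k. ennreal (4^k * (L2_norm (d k))\<^sup>2))"
    using dm by (simp add: ennreal_mult' nn_integral_cmult L2_nn_integral[OF dL2])
  also have "\<dots> \<le> (\<Sum>k. ennreal ((1/4)^k))"
  proof (intro suminf_le ennreal_leI)
    fix k
    have "L2_norm (d k) < (1/4)^k"
      unfolding d_def by (rule N) (auto intro: rN)
    then have "(L2_norm (d k))\<^sup>2 \<le> ((1/4)^k)\<^sup>2"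
      using L2_norm_nonneg by (intro power_mono) auto
    then have "4^k * (L2_norm (d k))\<^sup>2 \<le> 4^k * ((1/4)^k)\<^sup>2"
      by simp
    also have "\<dots> = (1/4)^k" by (simp add: power2_eq_square power_divide)
    finally show "4^k * (L2_norm (d k))\<^sup>2 \<le> (1/4)^k" .
  qed auto
  also have "\<dots> = ennreal (\<Sum>k. (1/4)^k)"
    by (intro suminf_ennreal2) (auto intro: summable_geometric)
  also have "\<dots> < \<infinity>" by simp
  finally have fin: "(\<integral>\<^sup>+t. (\<Sum>k. ennreal (4^k * (cmod (d k t))\<^sup>2)) \<partial>lebesgue) \<noteq> \<infinity>"
    by simp
  have "AE t in lebesgue. (\<Sum>k. ennreal (4^k * (cmod (d k t))\<^sup>2)) \<noteq> \<infinity>"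
    using dm by (intro nn_integral_PInf_AE[OF _ fin]) measurable
  then have conv: "AE t in lebesgue. convergent (\<lambda>k. f (r k) t)"
  proof eventually_elim
    case (elim t)
    define S where "S = (\<Sum>k. ennreal (4^k * (cmod (d k t))\<^sup>2))"
    define C where "C = enn2real S"
    have C: "C \<ge> 0" "S = ennreal C"
      using elim by (auto simp: C_def S_def less_top)
    have bd: "cmod (d k t) \<le> sqrt C * (1/2)^k" for k
    proof (rule power2_le_imp_le)
      have "ennreal (4^k * (cmod (d k t))\<^sup>2) \<le> ennreal C"
        unfolding C(2)[symmetric] S_def
        by (rule order_trans[OF _ sum_le_suminf[OF summableI, of "{k}"]]) simp_all
      then have "4^k * (cmod (d k t))\<^sup>2 \<le> C" by (simp only: ennreal_le_iff[OF C(1)])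
      then have "(1/4)^k * (4^k * (cmod (d k t))\<^sup>2) \<le> (1/4)^k * C" by (intro mult_left_mono) auto
      then have "(cmod (d k t))\<^sup>2 \<le> C * (1/4)^k" by (simp add: power_divide mult.commute)
      also have "(1/4::real)^k = ((1/2)^k)\<^sup>2"
        by (induction k) (auto simp: power2_eq_square)
      also have "C * ((1/2)^k)\<^sup>2 = (sqrt C * (1/2)^k)\<^sup>2"
        using C by (simp add: power_mult_distrib)
      finally show "(cmod (d k t))\<^sup>2 \<le> (sqrt C * (1/2)^k)\<^sup>2" .
    qed (use C in simp)
    have "summable (\<lambda>k. sqrt C * (1/2)^k)"
      by (intro summable_mult summable_geometric) simp
    then have "summable (\<lambda>k. d k t)"
      using bd by (rule summable_comparison_test'[where N=0])
    then have "convergent (\<lambda>k. \<Sum>j<k. d j t)" by (simp add: summable_iff_convergent)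
    then have "convergent (\<lambda>k. f (r 0) t + (\<Sum>j<k. d j t))"
      by (intro convergent_add convergent_const)
    moreover have "f (r 0) t + (\<Sum>j<k. d j t) = f (r k) t" for k
      by (simp add: d_def sum_lessThan_telescope[of "\<lambda>k. f (r k) t"])
    ultimately show ?case by simp
  qed
  define g where "g t = lim (\<lambda>k. f (r k) t)" for t
  have gm: "g \<in> borel_measurable lebesgue"
    unfolding g_def by (intro borel_measurable_lim_metric L2_borel f)
  have bound: "(\<integral>\<^sup>+t. ennreal ((cmod (f n t - g t))\<^sup>2) \<partial>lebesgue) \<le> ennreal (((1/4)^k)\<^sup>2)"
    if n: "n \<ge> N k" for k n
  proof -
    have "(\<integral>\<^sup>+t. ennreal ((cmod (f n t - g t))\<^sup>2) \<partial>lebesgue)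
        = (\<integral>\<^sup>+t. liminf (\<lambda>j. ennreal ((cmod (f n t - f (r j) t))\<^sup>2)) \<partial>lebesgue)"
    proof (intro nn_integral_cong_AE, use conv in eventually_elim)
      case (elim t)
      then have "(\<lambda>j. f (r j) t) \<longlonglongrightarrow> g t"
        by (simp add: g_def convergent_LIMSEQ_iff)
      then have "(\<lambda>j. ennreal ((cmod (f n t - f (r j) t))\<^sup>2)) \<longlonglongrightarrow> ennreal ((cmod (f n t - g t))\<^sup>2)"
        by (intro tendsto_intros tendsto_ennrealI)
      then show ?case by (rule lim_imp_Liminf[OF sequentially_bot, symmetric])
    qed
    also have "\<dots> \<le> liminf (\<lambda>j. \<integral>\<^sup>+t. ennreal ((cmod (f n t - f (r j) t))\<^sup>2) \<partial>lebesgue)"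
      using L2_borel[OF f] by (intro nn_integral_liminf) measurable
    also have "\<dots> \<le> liminf (\<lambda>j. ennreal (((1/4)^k)\<^sup>2))"
    proof (intro Liminf_mono eventually_sequentiallyI)
      fix j assume "k \<le> j"
      then have "L2_norm (\<lambda>t. f n t - f (r j) t) < (1/4)^k"
        by (intro N n rN)
      then show "(\<integral>\<^sup>+t. ennreal ((cmod (f n t - f (r j) t))\<^sup>2) \<partial>lebesgue) \<le> ennreal (((1/4)^k)\<^sup>2)"
        using L2_norm_nonneg
        by (subst L2_nn_integral) (auto intro!: L2_diff f ennreal_leI power_mono less_imp_le)
    qed
    finally show ?thesis by (simp add: Liminf_const)
  qed
  have diffm: "(\<lambda>t. f n t - g t) \<in> borel_measurable lebesgue" for n
    using gm L2_borel[OF f] by measurable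
  have "(\<lambda>t. f (N 0) t - g t) \<in> L2"
    by (rule L2I_nn_integral[OF diffm bound[of 0]]) simp
  then have "(\<lambda>t. f (N 0) t - (f (N 0) t - g t)) \<in> L2"
    by (rule L2_diff[OF f])
  then have "g \<in> L2" by simp
  moreover have "(\<lambda>n. L2_norm (\<lambda>t. f n t - g t)) \<longlonglongrightarrow> 0"
  proof (rule LIMSEQ_I)
    fix e :: real assume "e > 0"
    then obtain k where k: "(1/4)^k < e" using real_arch_pow_inv[of e "1/4"] by auto
    have "L2_norm (\<lambda>t. f n t - g t) < e" if "n \<ge> N k" for n
      using L2_norm_le_nn_integral[OF diffm _ bound[OF that]] k by fastforce
    then show "\<exists>no. \<forall>n\<ge>no. norm (L2_norm (\<lambda>t. f n t - g t) - 0) < e"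
      using L2_norm_nonneg by auto
  qed
  ultimately show ?thesis by (rule that)
qed

text \<open>
The radial retraction of the plane onto the disc of radius \<open>n\<close>. Unlike multiplication by an indicator,
it is continuous, so it turns continuous approximants into bounded continuous ones.
\<close>

definition radial_clamp :: "real \<Rightarrow> complex \<Rightarrow> complex" where
  "radial_clamp n z = complex_of_real (n / max n (cmod z)) * z"

lemma norm_radial_clamp: assumes "n > 0" shows "cmod (radial_clamp n z) \<le> n" "cmod (radial_clamp n z) \<le> cmod z"
proof -
  have e: "cmod (radial_clamp n z) = n / max n (cmod z) * cmod z"
    using assms unfolding radial_clamp_def norm_mult by (simp del: of_real_divide)
  have "n / max n (cmod z) * cmod z \<le> 1 * cmod z"
    using assms by (intro mult_right_mono) (auto simp: divide_le_eq)
  then show "cmod (radial_clamp n z) \<le> cmod z" using e by simp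
  have "cmod z / max n (cmod z) \<le> 1" using assms by (auto simp: divide_le_eq)
  then show "cmod (radial_clamp n z) \<le> n"
    using e assms mult_left_mono[of "cmod z / max n (cmod z)" 1 n] by simp
qed

lemma radial_clamp_eq: "n > 0 \<Longrightarrow> cmod z \<le> n \<Longrightarrow> radial_clamp n z = z"
  by (simp add: radial_clamp_def max_def)

lemma continuous_radial_clamp [continuous_intros]:
  assumes "n > 0" "continuous_on S f" shows "continuous_on S (\<lambda>x. radial_clamp n (f x))"
  unfolding radial_clamp_def using assms(1)
  by (intro continuous_intros assms(2)) (auto simp: max_def)

definition cutoff :: "real \<Rightarrow> real \<Rightarrow> real" where
  "cutoff n t = max 0 (min 1 (n + 1 - \<bar>t\<bar>))"

lemma continuous_cutoff [continuous_intros]: "continuous_on S (cutoff n)"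
  unfolding cutoff_def by (auto intro!: continuous_intros)

lemma cutoff_bounds: "0 \<le> cutoff n t" "cutoff n t \<le> 1" "cutoff n t \<le> indicator {-n-1..n+1} t"
  by (auto simp: cutoff_def indicator_def)

lemma L2_indicator_Icc: "(\<lambda>t. c * indicator {a..b} t) \<in> L2"
proof -
  have "integrable lebesgue (\<lambda>t. (cmod c)\<^sup>2 * indicator {a..b} t)"
    by (intro integrable_mult_right integrable_real_indicator) (auto simp: emeasure_lborel_Icc_eq)
  moreover have "(cmod (c * indicator {a..b} t))\<^sup>2 = (cmod c)\<^sup>2 * indicator {a..b} t" for t
    by (simp add: indicator_def)
  moreover have "(\<lambda>t. c * indicator {a..b} t) \<in> borel_measurable lebesgue"
    by (intro borel_measurable_times borel_measurable_indicator) auto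
  ultimately show ?thesis unfolding L2_def by simp
qed

lemma norm_truncation:
  assumes "n > 0" shows "cmod (radial_clamp n z * cutoff n t) \<le> cmod z"
proof -
  have "cmod (radial_clamp n z) * cutoff n t \<le> cmod z * 1"
    using assms by (intro mult_mono norm_radial_clamp cutoff_bounds) auto
  then show ?thesis using cutoff_bounds(1)[of n t] by (simp add: norm_mult)
qed

lemma borel_measurable_truncation:
  assumes f: "f \<in> borel_measurable lebesgue" and n: "n > 0"
  shows "(\<lambda>t. radial_clamp n (f t) * cutoff n t) \<in> borel_measurable lebesgue"
proof (intro borel_measurable_times)
  have "radial_clamp n \<in> borel_measurable borel"
    using continuous_radial_clamp[OF n continuous_on_id, of UNIV]
    by (auto intro!: borel_measurable_continuous_onI)
  then show "(\<lambda>t. radial_clamp n (f t)) \<in> borel_measurable lebesgue"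
    using f by (rule measurable_compose[rotated])
  have "(\<lambda>t. complex_of_real (cutoff n t)) \<in> borel_measurable lborel"
    by (auto intro!: borel_measurable_continuous_onI continuous_intros)
  then show "(\<lambda>t. complex_of_real (cutoff n t)) \<in> borel_measurable lebesgue"
    by (rule measurable_completion)
qed

lemma L2_truncate:
  assumes "f \<in> L2"
  shows "(\<lambda>n. L2_norm (\<lambda>t. radial_clamp (Suc n) (f t) * cutoff (Suc n) t - f t)) \<longlonglongrightarrow> 0"
proof (rule L2_dominated_convergence[where w=f])
  show "(\<lambda>t. radial_clamp (Suc n) (f t) * cutoff (Suc n) t) \<in> borel_measurable lebesgue" for n
    using assms by (intro borel_measurable_truncation L2_borel) auto
  show "AE t in lebesgue. cmod (radial_clamp (Suc n) (f t) * cutoff (Suc n) t) \<le> cmod (f t)" for n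
    by (intro AE_I2 norm_truncation) simp
  show "AE t in lebesgue. (\<lambda>n. radial_clamp (Suc n) (f t) * cutoff (Suc n) t) \<longlonglongrightarrow> f t"
  proof (intro AE_I2 tendsto_eventually eventually_sequentiallyI)
    fix t and n :: nat assume "nat \<lceil>max (cmod (f t)) \<bar>t\<bar>\<rceil> \<le> n"
    then have "cmod (f t) \<le> Suc n" "\<bar>t\<bar> \<le> Suc n" by linarith+
    then show "radial_clamp (Suc n) (f t) * cutoff (Suc n) t = f t"
      by (simp add: radial_clamp_eq cutoff_def)
  qed
qed (use assms in \<open>auto dest: L2_borel\<close>)

text \<open>
A Lebesgue measurable function is an almost everywhere limit of continuous functions. Truncating these in
height and width with the same continuous truncation as \<open>f\<close> makes dominated convergence applicable.
\<close>

theorem L2_dense_continuous: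
  assumes f: "f \<in> L2" and e: "e > 0"
  obtains g M where "g \<in> L2" "integrable lebesgue g" "continuous_on UNIV g" "\<And>t. cmod (g t) \<le> M"
    "L2_norm (\<lambda>t. g t - f t) < e"
proof -
  obtain n where "L2_norm (\<lambda>t. radial_clamp (Suc n) (f t) * cutoff (Suc n) t - f t) < e/2"
    using order_tendstoD(2)[OF L2_truncate[OF f], of "e/2"] e eventually_happens'[OF sequentially_bot] by auto
  define c where "c = real (Suc n)"
  have c: "c > 0" and n: "L2_norm (\<lambda>t. radial_clamp c (f t) * cutoff c t - f t) < e/2"
    using \<open>L2_norm _ < e/2\<close> by (auto simp: c_def)
  have "f measurable_on UNIV"
    using L2_borel[OF f] by (simp add: lebesgue_measurable_imp_measurable_on)
  then obtain N G where N: "negligible N" and G: "\<And>m. continuous_on UNIV (G m)"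
      and lim: "\<And>t. t \<notin> N \<Longrightarrow> (\<lambda>m. G m t) \<longlonglongrightarrow> f t"
    unfolding measurable_on_def by auto
  define g where "g m t = radial_clamp c (G m t) * cutoff c t" for m :: nat and t
  have gc: "continuous_on UNIV (g m)" for m
    unfolding g_def using c by (intro continuous_intros G)
  have gm: "g m \<in> borel_measurable lebesgue" for m
    using borel_measurable_continuous_onI[OF gc] by (auto intro: measurable_completion)
  have fm: "(\<lambda>t. radial_clamp c (f t) * cutoff c t) \<in> borel_measurable lebesgue"
    by (rule borel_measurable_truncation[OF L2_borel[OF f] c])
  have gb: "cmod (g m t) \<le> c * indicator {-c-1..c+1} t" for m t
    unfolding g_def norm_mult using norm_radial_clamp(1)[OF c] cutoff_bounds[of c t] c by (intro mult_mono) auto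
  have w: "(\<lambda>t. complex_of_real c * indicator {-c-1..c+1} t) \<in> L2" by (rule L2_indicator_Icc)
  have wb: "cmod (g m t) \<le> cmod (complex_of_real c * indicator {-c-1..c+1} t)" for m t
    using gb[of m t] c by (cases "t \<in> {-c-1..c+1}") (simp_all add: norm_mult)
  have gL2: "g m \<in> L2" for m
    by (rule L2_dominated[OF w gm, where M=1]) (use wb in simp)
  have "AE t in lebesgue. t \<notin> N" using N by (simp add: AE_not_in negligible_iff_null_sets)
  then have "AE t in lebesgue. (\<lambda>m. g m t) \<longlonglongrightarrow> radial_clamp c (f t) * cutoff c t"
  proof eventually_elim
    case (elim t)
    have "isCont (radial_clamp c) (f t)" using continuous_radial_clamp[OF c continuous_on_id, of UNIV]
      by (simp add: continuous_on_eq_continuous_at)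
    then have "(\<lambda>m. radial_clamp c (G m t)) \<longlonglongrightarrow> radial_clamp c (f t)"
      using lim[OF elim] by (rule isCont_tendsto_compose)
    then show ?case unfolding g_def by (intro tendsto_intros)
  qed
  then have "(\<lambda>m. L2_norm (\<lambda>t. g m t - radial_clamp c (f t) * cutoff c t)) \<longlonglongrightarrow> 0"
    by (rule L2_dominated_convergence[OF fm gm w, rotated])
      (rule AE_I2[OF wb])
  then obtain m where m: "L2_norm (\<lambda>t. g m t - radial_clamp c (f t) * cutoff c t) < e/2"
    using order_tendstoD(2)[of _ 0 sequentially "e/2"] e eventually_happens'[OF sequentially_bot] by auto
  have "(\<lambda>t. radial_clamp c (f t) * cutoff c t) \<in> L2"
    by (rule L2_dominated[OF f fm, where M=1])
      (use norm_truncation[OF c] in simp)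
  from L2_norm_triangle_diff[OF gL2[of m] this f] m n
  have "L2_norm (\<lambda>t. g m t - f t) < e" by fastforce
  moreover have "integrable lebesgue (g m)"
  proof (rule Bochner_Integration.integrable_bound[OF _ gm])
    show "integrable lebesgue (\<lambda>t. c * indicator {-c-1..c+1} t)" by (simp add: integrable_real_indicator emeasure_lborel_Icc_eq)
    show "AE t in lebesgue. norm (g m t) \<le> norm (c * indicator {-c-1..c+1} t :: real)"
      using gb[of m] c by (intro AE_I2) (simp add: abs_mult)
  qed
  moreover have "cmod (g m t) \<le> c" for t
    using gb[of m t] c by (cases "t \<in> {-c-1..c+1}") simp_all
  ultimately show ?thesis using gL2 gc by (intro that)
qed

section \<open>Plancherel's theorem on \<open>L\<^sup>1 \<inter> L\<^sup>2\<close>\<close>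

lemma fourier_L1_lborel:
  assumes [measurable]: "h \<in> borel_measurable borel"
  shows "fourier_L1 h \<xi> = (LINT t|lborel. h t * exp (- \<i> * complex_of_real (t * \<xi>)))"
  unfolding fourier_L1_def by (rule integral_completion) measurable

lemma norm_exp_ii [simp]: "cmod (exp (- \<i> * complex_of_real r)) = 1" "cmod (exp (- (\<i> * complex_of_real r))) = 1"
  using norm_exp_i_times[of "-r"] by simp_all

lemma integrable_mult_bounded:
  fixes f g :: "'a \<Rightarrow> complex"
  assumes "integrable M f" "g \<in> borel_measurable M" "\<And>t. cmod (g t) \<le> C"
  shows "integrable M (\<lambda>t. f t * g t)"
proof (rule Bochner_Integration.integrable_bound[of M "\<lambda>t. C * cmod (f t)"])
  show "integrable M (\<lambda>t. C * cmod (f t))" using assms(1) by simp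
  show "(\<lambda>t. f t * g t) \<in> borel_measurable M" using assms(1,2) by measurable
  have "C \<ge> 0" using order_trans[OF norm_ge_zero assms(3)] .
  then show "AE t in M. norm (f t * g t) \<le> norm (C * cmod (f t))"
    using mult_right_mono[OF assms(3), of "cmod (f _)"] by (intro AE_I2) (simp add: norm_mult mult.commute)
qed

lemma integrable_fourier_kernel:
  assumes "integrable lborel h"
  shows "integrable lborel (\<lambda>t. h t * exp (- \<i> * complex_of_real (t * \<xi>)))"
  by (rule integrable_mult_bounded[where C=1]) (use assms in auto)

lemma norm_fourier_L1_le:
  assumes "integrable lborel h"
  shows "cmod (fourier_L1 h \<xi>) \<le> (LINT t|lborel. cmod (h t))"
proof -
  have [measurable]: "h \<in> borel_measurable borel" using assms by auto
  show ?thesis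
    unfolding fourier_L1_lborel[OF \<open>h \<in> _\<close>]
    by (rule order_trans[OF integral_norm_bound]) (simp add: norm_mult)
qed

lemma borel_measurable_fourier_L1 [measurable]:
  assumes "h \<in> borel_measurable borel"
  shows "fourier_L1 h \<in> borel_measurable borel"
proof -
  note [measurable] = assms
  have "(\<lambda>\<xi>. LINT t|lborel. h t * exp (- \<i> * complex_of_real (t * \<xi>))) \<in> borel_measurable borel"
    by measurable
  then show ?thesis using fourier_L1_lborel[OF assms] by (simp cong: measurable_cong)
qed

lemma integrable_product_bound:
  fixes F :: "real \<times> real \<Rightarrow> complex"
  assumes f: "integrable lborel f" and g: "integrable lborel g"
    and m: "F \<in> borel_measurable (lborel \<Otimes>\<^sub>M lborel)"
    and b: "\<And>x y. cmod (F (x, y)) \<le> cmod (f x) * cmod (g y)"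
  shows "integrable (lborel \<Otimes>\<^sub>M lborel) F"
proof -
  have [measurable]: "f \<in> borel_measurable borel" "g \<in> borel_measurable borel" using f g by auto
  have *: "integrable (lborel \<Otimes>\<^sub>M lborel) (\<lambda>z. complex_of_real (cmod (f (fst z)) * cmod (g (snd z))))"
  proof (rule lborel_pair.Fubini_integrable)
    show "integrable lborel (\<lambda>x. \<integral>y. norm (complex_of_real (cmod (f (fst (x, y))) * cmod (g (snd (x, y))))) \<partial>lborel)"
      using f by (simp add: norm_mult)
    show "AE x in lborel. integrable lborel (\<lambda>y. complex_of_real (cmod (f (fst (x, y))) * cmod (g (snd (x, y)))))"
      using g by simp
  qed measurable
  show ?thesis
  proof (rule Bochner_Integration.integrable_bound[OF * m])
    show "AE z in lborel \<Otimes>\<^sub>M lborel. norm (F z) \<le> norm (complex_of_real (cmod (f (fst z)) * cmod (g (snd z))))"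
      using b by (intro AE_I2) (auto simp: norm_mult)
  qed
qed

text \<open>
The multiplication formula. The kernel \<open>f x * g \<xi> * exp(-ix\<xi>)\<close> is dominated by a product of integrable
functions, so Fubini's theorem exchanges the two integrations.
\<close>

lemma fourier_L1_multiplication_formula:
  assumes f: "integrable lborel f" and g: "integrable lborel g"
  shows "(LINT \<xi>|lborel. fourier_L1 f \<xi> * g \<xi>) = (LINT x|lborel. f x * fourier_L1 g x)"
proof -
  have [measurable]: "f \<in> borel_measurable borel" "g \<in> borel_measurable borel" using f g by auto
  let ?F = "\<lambda>x \<xi>. f x * g \<xi> * exp (- \<i> * complex_of_real (x * \<xi>))"
  have "integrable (lborel \<Otimes>\<^sub>M lborel) (case_prod ?F)"
    by (rule integrable_product_bound[OF f g]) (auto simp: norm_mult)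
  then have "(LINT \<xi>|lborel. LINT x|lborel. ?F x \<xi>) = (LINT x|lborel. LINT \<xi>|lborel. ?F x \<xi>)"
    by (rule lborel_pair.Fubini_integral)
  moreover have "(LINT x|lborel. ?F x \<xi>) = fourier_L1 f \<xi> * g \<xi>" for \<xi>
  proof -
    have "?F x \<xi> = g \<xi> * (f x * exp (- \<i> * complex_of_real (x * \<xi>)))" for x by simp
    then have "(LINT x|lborel. ?F x \<xi>) = (LINT x|lborel. g \<xi> * (f x * exp (- \<i> * complex_of_real (x * \<xi>))))"
      by (simp only:)
    then show ?thesis by (simp add: fourier_L1_lborel mult.commute)
  qed
  moreover have "(LINT \<xi>|lborel. ?F x \<xi>) = f x * fourier_L1 g x" for x
  proof -
    have "?F x \<xi> = f x * (g \<xi> * exp (- \<i> * complex_of_real (\<xi> * x)))" for \<xi>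
      by (simp add: mult.commute)
    then have "(LINT \<xi>|lborel. ?F x \<xi>) = (LINT \<xi>|lborel. f x * (g \<xi> * exp (- \<i> * complex_of_real (\<xi> * x))))"
      by (simp only:)
    then show ?thesis by (simp add: fourier_L1_lborel)
  qed
  ultimately show ?thesis by simp
qed

definition gauss_weight :: "real \<Rightarrow> real \<Rightarrow> complex" where
  "gauss_weight e \<xi> = complex_of_real (exp (- ((e * \<xi>)\<^sup>2) / 2))"

lemma gauss_weight_eq: "gauss_weight e \<xi> = complex_of_real (sqrt (2 * pi) * std_normal_density (e * \<xi>))"
  by (simp add: gauss_weight_def std_normal_density_def)

lemma borel_measurable_gauss_weight [measurable]: "gauss_weight e \<in> borel_measurable borel"
  unfolding gauss_weight_def by measurable

lemma integrable_gauss_weight: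
  assumes "e \<noteq> 0" shows "integrable lborel (gauss_weight e)"
proof -
  have "integrable lborel (\<lambda>x. std_normal_density (0 + e * x))"
    using assms by (intro lborel_integrable_real_affine integrable_normal_density) auto
  then show ?thesis unfolding gauss_weight_eq[abs_def] by simp
qed

lemma fourier_L1_gauss_weight:
  assumes e: "e > 0"
  shows "fourier_L1 (gauss_weight e) u = complex_of_real (2 * pi / e * std_normal_density (u / e))"
proof -
  have "fourier_L1 (gauss_weight e) u
      = (LINT t|lborel. complex_of_real (sqrt (2 * pi) * std_normal_density (e * t)) * exp (- \<i> * complex_of_real (t * u)))"
    unfolding fourier_L1_lborel[OF borel_measurable_gauss_weight] gauss_weight_eq ..
  also have "\<dots> = (1 / e) *\<^sub>R (LINT t|lborel. complex_of_real (sqrt (2 * pi) * std_normal_density t) * exp (- \<i> * complex_of_real (t * (u / e))))"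
    using e by (subst lborel_integral_real_affine[where c=e and t=0]) (auto simp: field_simps)
  also have "(LINT t|lborel. complex_of_real (sqrt (2 * pi) * std_normal_density t) * exp (- \<i> * complex_of_real (t * (u / e))))
     = sqrt (2 * pi) * (LINT t|lborel. std_normal_density t *\<^sub>R iexp (- (u / e) * t))"
    by (subst integral_mult_right_zero[symmetric])
      (intro Bochner_Integration.integral_cong refl, simp add: scaleR_conv_of_real mult_ac)
  also have "(LINT t|lborel. std_normal_density t *\<^sub>R iexp (- (u / e) * t)) = char std_normal_distribution (- (u / e))"
    unfolding char_def by (subst integral_density) auto
  also have "char std_normal_distribution (- (u / e)) = complex_of_real (exp (- ((u / e)\<^sup>2) / 2))"
    by (simp add: char_std_normal_distribution)
  also have "(1 / e) *\<^sub>R (complex_of_real (sqrt (2 * pi)) * complex_of_real (exp (- ((u / e)\<^sup>2) / 2)))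
      = complex_of_real (sqrt (2 * pi) / e * exp (- ((u / e)\<^sup>2) / 2))"
    by (simp add: scaleR_conv_of_real)
  also have "sqrt (2 * pi) = 2 * pi / sqrt (2 * pi)"
    by (rule real_div_sqrt[symmetric]) simp
  also have "complex_of_real (2 * pi / sqrt (2 * pi) / e * exp (- ((u / e)\<^sup>2) / 2))
      = complex_of_real (2 * pi / e * std_normal_density (u / e))"
    by (simp add: std_normal_density_def)
  finally show ?thesis .
qed

lemma fourier_L1_modulate:
  assumes [measurable]: "g \<in> borel_measurable borel"
  shows "fourier_L1 (\<lambda>\<xi>. g \<xi> * exp (- \<i> * complex_of_real (\<xi> * x))) y = fourier_L1 g (x + y)"
  by (simp add: fourier_L1_lborel mult.assoc distrib_left flip: exp_add of_real_add)
     (simp add: algebra_simps)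

lemma borel_measurable_cnj [measurable]: "cnj \<in> borel_measurable borel"
  by (intro borel_measurable_continuous_onI continuous_intros)

lemma fourier_L1_cnj_reflect:
  assumes [measurable]: "h \<in> borel_measurable borel"
  shows "fourier_L1 (\<lambda>y. cnj (h (- y))) \<xi> = cnj (fourier_L1 h \<xi>)"
proof -
  have "fourier_L1 (\<lambda>y. cnj (h (- y))) \<xi> = (LINT t|lborel. cnj (h (- t)) * exp (- \<i> * complex_of_real (t * \<xi>)))"
    by (rule fourier_L1_lborel) measurable
  also have "\<dots> = (LINT t|lborel. cnj (h t) * exp (\<i> * complex_of_real (t * \<xi>)))"
    by (subst lborel_integral_real_affine[where c="-1" and t=0]) auto
  also have "\<dots> = (LINT t|lborel. cnj (h t * exp (- \<i> * complex_of_real (t * \<xi>))))"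
    by (simp add: exp_cnj)
  also have "\<dots> = cnj (fourier_L1 h \<xi>)"
    unfolding fourier_L1_lborel[OF assms] by (rule Bochner_Integration.integral_cnj)
  finally show ?thesis .
qed

text \<open>
The function \<open>\<bar>h^\<bar>\<^sup>2\<close> is not known to be integrable, so it is damped by a Gaussian weight \<open>w\<close>. Writing
\<open>\<bar>h^\<bar>\<^sup>2 w\<close> as \<open>h^ * (cnj h^ * w)\<close>, and \<open>cnj h^\<close> as the transform of \<open>cnj (h (- y))\<close>, two applications of the
multiplication formula transfer the transform to the Gaussian. What remains is the autocorrelation of \<open>h\<close>
averaged over shifts of size \<open>e\<close>.
\<close>

lemma gaussian_regularised_plancherel:
  assumes h: "integrable lborel h" and e: "e > 0"
  shows "(LINT \<xi>|lborel. (cmod (fourier_L1 h \<xi>))\<^sup>2 * exp (- ((e * \<xi>)\<^sup>2) / 2))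
    = 2 * pi * (LINT x|lborel. h x * (LINT v|lborel. cnj (h (x - e * v)) * std_normal_density v))"
proof -
  have hm[measurable]: "h \<in> borel_measurable borel" using h by auto
  let ?hh = "fourier_L1 h" and ?w = "gauss_weight e"
  let ?g = "\<lambda>\<xi>. cnj (?hh \<xi>) * ?w \<xi>"
  have hr: "integrable lborel (\<lambda>y. cnj (h (- y)))"
    using lborel_integrable_real_affine[OF h, of "-1" 0] by simp
  have wi: "integrable lborel ?w" using e by (intro integrable_gauss_weight) auto
  have wix: "integrable lborel (\<lambda>\<xi>. ?w \<xi> * exp (- \<i> * complex_of_real (\<xi> * x)))" for x
    by (rule integrable_fourier_kernel[OF wi])
  have gi: "integrable lborel ?g"
    by (subst mult.commute, rule integrable_mult_bounded[OF wi, where C="LINT t|lborel. cmod (h t)"])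
      (simp_all add: norm_fourier_L1_le[OF h])
  have inner: "fourier_L1 ?g x = 2 * pi * (LINT v|lborel. cnj (h (x - e * v)) * std_normal_density v)" for x
  proof -
    have "fourier_L1 ?g x = (LINT \<xi>|lborel. fourier_L1 (\<lambda>y. cnj (h (- y))) \<xi> * (?w \<xi> * exp (- \<i> * complex_of_real (\<xi> * x))))"
      by (subst fourier_L1_lborel) (simp_all add: fourier_L1_cnj_reflect mult.assoc)
    also have "\<dots> = (LINT y|lborel. cnj (h (- y)) * fourier_L1 ?w (x + y))"
      unfolding fourier_L1_multiplication_formula[OF hr wix]
    by (simp only: fourier_L1_modulate[OF borel_measurable_gauss_weight])
    also have "\<dots> = e *\<^sub>R (LINT v|lborel. cnj (h (x - e * v)) * fourier_L1 ?w (e * v))"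
      using e by (subst lborel_integral_real_affine[where c=e and t="-x"]) (auto simp: algebra_simps)
    also have "\<dots> = e *\<^sub>R (LINT v|lborel. complex_of_real (2 * pi / e) * (cnj (h (x - e * v)) * std_normal_density v))"
      using e by (simp add: fourier_L1_gauss_weight mult_ac)
    also have "\<dots> = 2 * pi * (LINT v|lborel. cnj (h (x - e * v)) * std_normal_density v)"
      using e by (simp add: scaleR_conv_of_real)
    finally show ?thesis .
  qed
  have "complex_of_real (LINT \<xi>|lborel. (cmod (?hh \<xi>))\<^sup>2 * exp (- ((e * \<xi>)\<^sup>2) / 2))
      = (LINT \<xi>|lborel. ?hh \<xi> * ?g \<xi>)"
    unfolding integral_complex_of_real[symmetric]
    by (simp add: gauss_weight_def complex_norm_square mult.assoc del: of_real_power)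
  also have "\<dots> = (LINT x|lborel. h x * fourier_L1 ?g x)"
    by (rule fourier_L1_multiplication_formula[OF h gi])
  also have "\<dots> = (LINT x|lborel. complex_of_real (2 * pi) * (h x * (LINT v|lborel. cnj (h (x - e * v)) * std_normal_density v)))"
    unfolding inner by (simp add: mult_ac)
  also have "\<dots> = 2 * pi * (LINT x|lborel. h x * (LINT v|lborel. cnj (h (x - e * v)) * std_normal_density v))"
    by simp
  finally show ?thesis .
qed


lemma norm_integral_le_nn_integral:
  fixes f :: "'a \<Rightarrow> 'b::{banach, second_countable_topology}"
  shows "ennreal (norm (integral\<^sup>L M f)) \<le> (\<integral>\<^sup>+x. ennreal (norm (f x)) \<partial>M)"
  by (cases "integrable M f") (auto simp: integral_norm_bound_ennreal not_integrable_integral_eq)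

lemma nn_integral_std_normal_density: "(\<integral>\<^sup>+v. ennreal (std_normal_density v) \<partial>lborel) = 1"
  by (subst nn_integral_eq_integral) (auto intro!: integrable_normal_density)

text \<open>
The autocorrelation is at most \<open>\<parallel>h\<parallel>\<^sup>2\<close>, because \<open>\<bar>h(x)\<bar> \<bar>h(x - s)\<bar> \<le> (\<bar>h(x)\<bar>\<^sup>2 + \<bar>h(x - s)\<bar>\<^sup>2) / 2\<close>.
\<close>

lemma gaussian_regularised_bound:
  assumes h: "integrable lborel h" "h \<in> L2" and e: "e > 0"
  shows "(LINT \<xi>|lborel. (cmod (fourier_L1 h \<xi>))\<^sup>2 * exp (- ((e * \<xi>)\<^sup>2) / 2)) \<le> 2 * pi * (L2_norm h)\<^sup>2"
proof -
  have [measurable]: "h \<in> borel_measurable borel" using h by auto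
  let ?J = "LINT x|lborel. h x * (LINT v|lborel. cnj (h (x - e * v)) * std_normal_density v)"
  let ?I = "LINT \<xi>|lborel. (cmod (fourier_L1 h \<xi>))\<^sup>2 * exp (- ((e * \<xi>)\<^sup>2) / 2)"
  let ?n = "\<integral>\<^sup>+x. ennreal ((cmod (h x))\<^sup>2) \<partial>lborel"
  have n: "?n = ennreal ((L2_norm h)\<^sup>2)"
    using L2_nn_integral[OF h(2)] by (simp add: nn_integral_completion)
  have shift: "(\<integral>\<^sup>+x. ennreal ((cmod (h (x - s)))\<^sup>2) \<partial>lborel) = ?n" for s
    using nn_integral_real_affine[of "\<lambda>x. ennreal ((cmod (h x))\<^sup>2)" 1 "-s"] by simp
  have "ennreal (norm ?J) \<le> (\<integral>\<^sup>+x. ennreal (norm (h x * (LINT v|lborel. cnj (h (x - e * v)) * std_normal_density v))) \<partial>lborel)"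
    by (rule norm_integral_le_nn_integral)
  also have "\<dots> \<le> (\<integral>\<^sup>+x. ennreal (cmod (h x)) * (\<integral>\<^sup>+v. ennreal (cmod (h (x - e * v)) * std_normal_density v) \<partial>lborel) \<partial>lborel)"
  proof (intro nn_integral_mono)
    fix x
    have "ennreal (norm (LINT v|lborel. cnj (h (x - e * v)) * std_normal_density v)) \<le> (\<integral>\<^sup>+v. ennreal (cmod (h (x - e * v)) * std_normal_density v) \<partial>lborel)"
      by (rule order_trans[OF norm_integral_le_nn_integral]) (simp add: norm_mult)
    then show "ennreal (norm (h x * (LINT v|lborel. cnj (h (x - e * v)) * std_normal_density v))) \<le> ennreal (cmod (h x)) * (\<integral>\<^sup>+v. ennreal (cmod (h (x - e * v)) * std_normal_density v) \<partial>lborel)"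
      by (simp add: norm_mult ennreal_mult mult_left_mono)
  qed
  also have "\<dots> = (\<integral>\<^sup>+x. \<integral>\<^sup>+v. ennreal (cmod (h x) * cmod (h (x - e * v)) * std_normal_density v) \<partial>lborel \<partial>lborel)"
    by (subst nn_integral_cmult[symmetric]) (auto simp: ennreal_mult mult.assoc)
  also have "\<dots> \<le> (\<integral>\<^sup>+x. \<integral>\<^sup>+v. ennreal (1/2 * ((cmod (h x))\<^sup>2 + (cmod (h (x - e * v)))\<^sup>2) * std_normal_density v) \<partial>lborel \<partial>lborel)"
  proof (intro nn_integral_mono ennreal_leI mult_right_mono)
    fix x v
    show "cmod (h x) * cmod (h (x - e * v)) \<le> 1/2 * ((cmod (h x))\<^sup>2 + (cmod (h (x - e * v)))\<^sup>2)"
      using sum_squares_bound[of "cmod (h x)" "cmod (h (x - e * v))"] by simp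
  qed auto
  also have "\<dots> = (\<integral>\<^sup>+v. \<integral>\<^sup>+x. ennreal (1/2 * ((cmod (h x))\<^sup>2 + (cmod (h (x - e * v)))\<^sup>2) * std_normal_density v) \<partial>lborel \<partial>lborel)"
    by (rule lborel_pair.Fubini'[symmetric]) measurable
  also have "\<dots> = (\<integral>\<^sup>+v. ennreal (std_normal_density v) * ennreal ((L2_norm h)\<^sup>2) \<partial>lborel)"
  proof (intro nn_integral_cong)
    fix v
    have "(\<integral>\<^sup>+x. ennreal (1/2 * ((cmod (h x))\<^sup>2 + (cmod (h (x - e * v)))\<^sup>2) * std_normal_density v) \<partial>lborel)
      = (\<integral>\<^sup>+x. ennreal (1/2 * std_normal_density v) * (ennreal ((cmod (h x))\<^sup>2) + ennreal ((cmod (h (x - e * v)))\<^sup>2)) \<partial>lborel)"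
      by (intro nn_integral_cong) (simp add: algebra_simps flip: ennreal_mult ennreal_plus)
    also have "\<dots> = ennreal (1/2 * std_normal_density v) * (?n + ?n)"
      by (simp add: nn_integral_cmult nn_integral_add shift)
    also have "\<dots> = ennreal (std_normal_density v) * ennreal ((L2_norm h)\<^sup>2)"
      unfolding n by (simp flip: ennreal_mult ennreal_plus)
    finally show "(\<integral>\<^sup>+x. ennreal (1/2 * ((cmod (h x))\<^sup>2 + (cmod (h (x - e * v)))\<^sup>2) * std_normal_density v) \<partial>lborel)
      = ennreal (std_normal_density v) * ennreal ((L2_norm h)\<^sup>2)" .
  qed
  also have "\<dots> = ennreal ((L2_norm h)\<^sup>2)"
    by (simp add: nn_integral_multc nn_integral_std_normal_density)
  finally have J: "norm ?J \<le> (L2_norm h)\<^sup>2" by simp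
  have "?I \<le> norm (complex_of_real ?I)" by simp
  also have "\<dots> = 2 * pi * norm ?J"
    unfolding gaussian_regularised_plancherel[OF h(1) e] by (simp add: norm_mult)
  also have "\<dots> \<le> 2 * pi * (L2_norm h)\<^sup>2" using J by simp
  finally show ?thesis .
qed

lemma integrable_fourier_L1_gauss:
  assumes h: "integrable lborel h" and e: "e > 0"
  shows "integrable lborel (\<lambda>\<xi>. (cmod (fourier_L1 h \<xi>))\<^sup>2 * exp (- ((e * \<xi>)\<^sup>2) / 2))"
proof (rule Bochner_Integration.integrable_bound)
  have [measurable]: "h \<in> borel_measurable borel" using h by auto
  let ?C = "LINT t|lborel. cmod (h t)"
  show "integrable lborel (\<lambda>\<xi>. ?C\<^sup>2 * cmod (gauss_weight e \<xi>))"
    using integrable_gauss_weight[of e] e by simp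
  show "(\<lambda>\<xi>. (cmod (fourier_L1 h \<xi>))\<^sup>2 * exp (- ((e * \<xi>)\<^sup>2) / 2)) \<in> borel_measurable lborel"
    by measurable
  show "AE \<xi> in lborel. norm ((cmod (fourier_L1 h \<xi>))\<^sup>2 * exp (- ((e * \<xi>)\<^sup>2) / 2)) \<le> norm (?C\<^sup>2 * cmod (gauss_weight e \<xi>))"
    using norm_fourier_L1_le[OF h]
    by (intro AE_I2) (auto simp: gauss_weight_def abs_mult intro!: mult_mono power_mono)
qed

text \<open>
As the weight tends to \<open>1\<close>, the bound survives by Fatou's lemma.
\<close>

lemma plancherel_le_borel:
  assumes h: "integrable lborel h" "h \<in> L2"
  shows "(\<integral>\<^sup>+\<xi>. ennreal ((cmod (fourier_L1 h \<xi>))\<^sup>2) \<partial>lborel) \<le> ennreal (2 * pi * (L2_norm h)\<^sup>2)"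
proof -
  have [measurable]: "h \<in> borel_measurable borel" using h by auto
  let ?u = "\<lambda>n \<xi>. (cmod (fourier_L1 h \<xi>))\<^sup>2 * exp (- ((1 / real (Suc n) * \<xi>)\<^sup>2) / 2)"
  have "(\<integral>\<^sup>+\<xi>. ennreal ((cmod (fourier_L1 h \<xi>))\<^sup>2) \<partial>lborel) = (\<integral>\<^sup>+\<xi>. liminf (\<lambda>n. ennreal (?u n \<xi>)) \<partial>lborel)"
  proof (intro nn_integral_cong lim_imp_Liminf[symmetric] tendsto_ennrealI)
    fix \<xi>
    have "(\<lambda>n. ?u n \<xi>) \<longlonglongrightarrow> (cmod (fourier_L1 h \<xi>))\<^sup>2 * exp (- ((0 * \<xi>)\<^sup>2) / 2)"
      by (intro tendsto_intros LIMSEQ_Suc[OF lim_1_over_n]) simp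
    then show "(\<lambda>n. ?u n \<xi>) \<longlonglongrightarrow> (cmod (fourier_L1 h \<xi>))\<^sup>2" by simp
  qed simp
  also have "\<dots> \<le> liminf (\<lambda>n. \<integral>\<^sup>+\<xi>. ennreal (?u n \<xi>) \<partial>lborel)"
    by (intro nn_integral_liminf) measurable
  also have "\<dots> \<le> liminf (\<lambda>n. ennreal (2 * pi * (L2_norm h)\<^sup>2))"
  proof (intro Liminf_mono always_eventually allI)
    fix n
    show "(\<integral>\<^sup>+\<xi>. ennreal (?u n \<xi>) \<partial>lborel) \<le> ennreal (2 * pi * (L2_norm h)\<^sup>2)"
      using gaussian_regularised_bound[OF h, of "1 / real (Suc n)"]
      by (subst nn_integral_eq_integral[OF integrable_fourier_L1_gauss[OF h(1)]]) auto
  qed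
  finally show ?thesis by (simp add: Liminf_const)
qed

text \<open>
For continuous bounded \<open>h\<close> the averaged autocorrelation tends to its value \<open>\<parallel>h\<parallel>\<^sup>2\<close> at shift \<open>0\<close> by dominated
convergence, and the weight is at most \<open>1\<close>.
\<close>

lemma plancherel_ge_continuous:
  assumes h: "integrable lborel h" "h \<in> L2" and cont: "continuous_on UNIV h" and M: "\<And>t. cmod (h t) \<le> M"
  shows "ennreal (2 * pi * (L2_norm h)\<^sup>2) \<le> (\<integral>\<^sup>+\<xi>. ennreal ((cmod (fourier_L1 h \<xi>))\<^sup>2) \<partial>lborel)"
proof -
  have hm[measurable]: "h \<in> borel_measurable borel" using h by auto
  have M0: "M \<ge> 0" using order_trans[OF norm_ge_zero M] .
  define K where "K n x = (LINT v|lborel. cnj (h (x - 1 / real (Suc n) * v)) * std_normal_density v)" for n x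
  have Km[measurable]: "K n \<in> borel_measurable borel" for n
    unfolding K_def by measurable
  have Ki: "integrable lborel (\<lambda>v. M * std_normal_density v)"
    by (intro integrable_mult_right integrable_normal_density) simp
  have Kb: "cmod (K n x) \<le> M" for n x
  proof -
    have "cmod (K n x) \<le> (LINT v|lborel. M * std_normal_density v)"
      unfolding K_def by (rule order_trans[OF integral_norm_bound integral_mono'[OF Ki]])
        (auto simp: norm_mult M M0 intro!: mult_right_mono mult_nonneg_nonneg)
    also have "\<dots> = M" by simp
    finally show ?thesis .
  qed
  have Kl: "(\<lambda>n. K n x) \<longlonglongrightarrow> cnj (h x)" for x
  proof -
    have "(\<lambda>n. K n x) \<longlonglongrightarrow> (LINT v|lborel. cnj (h x) * std_normal_density v)"
      unfolding K_def
    proof (rule integral_dominated_convergence[where w="\<lambda>v. M * std_normal_density v"])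
      show "AE v in lborel. (\<lambda>n. cnj (h (x - 1 / real (Suc n) * v)) * std_normal_density v) \<longlonglongrightarrow> cnj (h x) * std_normal_density v"
      proof (intro AE_I2 tendsto_intros)
        fix v
        have "(\<lambda>n. x - 1 / real (Suc n) * v) \<longlonglongrightarrow> x - 0 * v"
          by (intro tendsto_intros LIMSEQ_Suc[OF lim_1_over_n])
        then show "(\<lambda>n. h (x - 1 / real (Suc n) * v)) \<longlonglongrightarrow> h x"
          using cont by (intro isCont_tendsto_compose[of x h]) (auto simp: continuous_on_eq_continuous_at)
      qed
      show "AE v in lborel. norm (cnj (h (x - 1 / real (Suc n) * v)) * std_normal_density v) \<le> M * std_normal_density v" for n
        by (intro AE_I2) (auto simp: norm_mult M M0 intro!: mult_right_mono mult_nonneg_nonneg)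
    qed (use Ki in measurable)
    then show ?thesis by simp
  qed
  have "(\<lambda>n. LINT x|lborel. h x * K n x) \<longlonglongrightarrow> (LINT x|lborel. h x * cnj (h x))"
  proof (rule integral_dominated_convergence[where w="\<lambda>x. M * cmod (h x)"])
    show "integrable lborel (\<lambda>x. M * cmod (h x))" using h by simp
    show "AE x in lborel. (\<lambda>n. h x * K n x) \<longlonglongrightarrow> h x * cnj (h x)"
      by (intro AE_I2 tendsto_intros Kl)
    show "AE x in lborel. norm (h x * K n x) \<le> M * cmod (h x)" for n
      using mult_left_mono[OF Kb, of "cmod (h _)"] by (intro AE_I2) (simp add: norm_mult mult.commute)
  qed measurable
  also have "(LINT x|lborel. h x * cnj (h x)) = complex_of_real ((L2_norm h)\<^sup>2)"
    unfolding L2_norm_sq by (subst integral_completion) (auto simp: complex_norm_square[symmetric] simp flip: integral_complex_of_real)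
  finally have "(\<lambda>n. 2 * pi * cmod (LINT x|lborel. h x * K n x)) \<longlonglongrightarrow> 2 * pi * cmod (complex_of_real ((L2_norm h)\<^sup>2))"
    by (intro tendsto_intros)
  then have lim: "(\<lambda>n. ennreal (2 * pi * cmod (LINT x|lborel. h x * K n x))) \<longlonglongrightarrow> ennreal (2 * pi * (L2_norm h)\<^sup>2)"
    by (intro tendsto_ennrealI) (simp del: of_real_power)
  have "ennreal (2 * pi * cmod (LINT x|lborel. h x * K n x)) \<le> (\<integral>\<^sup>+\<xi>. ennreal ((cmod (fourier_L1 h \<xi>))\<^sup>2) \<partial>lborel)" for n
  proof -
    let ?u = "\<lambda>\<xi>. (cmod (fourier_L1 h \<xi>))\<^sup>2 * exp (- ((1 / real (Suc n) * \<xi>)\<^sup>2) / 2)"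
    have e: "1 / real (Suc n) > 0" by simp
    have "2 * pi * cmod (LINT x|lborel. h x * K n x) = cmod (complex_of_real (LINT \<xi>|lborel. ?u \<xi>))"
      unfolding K_def gaussian_regularised_plancherel[OF h(1) e] by (simp add: norm_mult)
    also have "\<dots> = (LINT \<xi>|lborel. ?u \<xi>)"
      by (simp add: integral_nonneg)
    finally have "ennreal (2 * pi * cmod (LINT x|lborel. h x * K n x)) = (\<integral>\<^sup>+\<xi>. ennreal (?u \<xi>) \<partial>lborel)"
      using nn_integral_eq_integral[OF integrable_fourier_L1_gauss[OF h(1) e]] by simp
    also have "\<dots> \<le> (\<integral>\<^sup>+\<xi>. ennreal ((cmod (fourier_L1 h \<xi>))\<^sup>2) \<partial>lborel)"
      by (intro nn_integral_mono ennreal_leI) (simp add: mult_left_le)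
    finally show ?thesis .
  qed
  then show ?thesis by (intro LIMSEQ_le_const2[OF lim]) auto
qed

lemma fourier_L1_cong_AE:
  assumes "AE t in lebesgue. f t = g t" "f \<in> borel_measurable lebesgue" "g \<in> borel_measurable lebesgue"
  shows "fourier_L1 f = fourier_L1 g"
proof
  fix \<xi>
  have m: "(\<lambda>t. exp (- \<i> * complex_of_real (t * \<xi>))) \<in> borel_measurable lebesgue"
    by (intro measurable_completion) measurable
  show "fourier_L1 f \<xi> = fourier_L1 g \<xi>"
    unfolding fourier_L1_def using assms
    by (intro integral_cong_AE borel_measurable_times m) auto
qed

lemma L1_L2_borel_representative:
  assumes "integrable lebesgue h" "h \<in> L2"
  obtains g where "integrable lborel g" "g \<in> L2" "L2_norm g = L2_norm h" "fourier_L1 g = fourier_L1 h" "AE t in lebesgue. h t = g t"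
proof -
  have hm: "h \<in> borel_measurable lebesgue" using assms(2) by (rule L2_borel)
  obtain g :: "real \<Rightarrow> complex" where g: "g \<in> borel_measurable borel" "AE t in lebesgue. h t = g t"
    by (rule L2_borel_representative[OF hm])
  have gm: "g \<in> borel_measurable lebesgue" using g(1) by (intro measurable_completion) simp
  have "integrable lebesgue g" using assms(1) g(2) gm hm by (simp cong: integrable_cong_AE)
  then have "integrable lborel g" using g(1) by (simp add: integrable_completion)
  then show ?thesis
    using that[of g] L2_cong_AE[OF assms(2) gm g(2)] L2_norm_cong_AE[OF hm gm g(2)] fourier_L1_cong_AE[OF g(2) hm gm] g(2) by simp
qed

lemma fourier_L1_L2:
  assumes "integrable lebesgue h" "h \<in> L2"
  shows "fourier_L1 h \<in> L2" and "L2_norm (fourier_L1 h) \<le> sqrt (2 * pi) * L2_norm h"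
    and "fourier_L1 h \<in> borel_measurable borel"
proof -
  obtain g where g: "integrable lborel g" "g \<in> L2" "L2_norm g = L2_norm h" "fourier_L1 g = fourier_L1 h"
    by (rule L1_L2_borel_representative[OF assms]) blast
  have "g \<in> borel_measurable borel" using g(1) by auto
  from borel_measurable_fourier_L1[OF this] show b: "fourier_L1 h \<in> borel_measurable borel" unfolding g(4) .
  then have m: "fourier_L1 h \<in> borel_measurable lebesgue" by (intro measurable_completion) simp
  have le: "(\<integral>\<^sup>+\<xi>. ennreal ((cmod (fourier_L1 h \<xi>))\<^sup>2) \<partial>lebesgue) \<le> ennreal ((sqrt (2 * pi) * L2_norm h)\<^sup>2)"
    using plancherel_le_borel[OF g(1,2)] by (simp add: nn_integral_completion g(3,4) power_mult_distrib)
  show "fourier_L1 h \<in> L2" by (rule L2I_nn_integral[OF m le])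
  show "L2_norm (fourier_L1 h) \<le> sqrt (2 * pi) * L2_norm h"
    by (rule L2_norm_le_nn_integral[OF m _ le]) (simp add: L2_norm_nonneg)
qed

lemma fourier_L1_kernel_integrable:
  assumes "integrable lebesgue f"
  shows "integrable lebesgue (\<lambda>t. f t * exp (- \<i> * complex_of_real (t * \<xi>)))"
proof (rule integrable_mult_bounded[OF assms, where C=1])
  show "(\<lambda>t. exp (- \<i> * complex_of_real (t * \<xi>))) \<in> borel_measurable lebesgue"
    by (intro measurable_completion) measurable
qed simp

lemma fourier_L1_diff:
  assumes "integrable lebesgue f" "integrable lebesgue g"
  shows "fourier_L1 (\<lambda>t. f t - g t) \<xi> = fourier_L1 f \<xi> - fourier_L1 g \<xi>"
  unfolding fourier_L1_def left_diff_distrib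
  by (intro Bochner_Integration.integral_diff fourier_L1_kernel_integrable assms)

text \<open>
The inequality \<open>\<parallel>h^\<parallel> \<le> sqrt(2\<pi>) \<parallel>h\<parallel>\<close> makes both sides continuous in \<open>h\<close> for the \<open>L\<^sup>2\<close> norm, so equality
extends from continuous bounded functions to all of \<open>L\<^sup>1 \<inter> L\<^sup>2\<close> by density.
\<close>

theorem plancherel:
  assumes h: "integrable lebesgue h" "h \<in> L2"
  shows "L2_norm (fourier_L1 h) = sqrt (2 * pi) * L2_norm h"
proof (rule antisym[OF fourier_L1_L2(2)[OF h] field_le_epsilon])
  fix e :: real assume e: "e > 0"
  define d where "d = e / (2 * sqrt (2 * pi))"
  have d: "d > 0" using e by (simp add: d_def)
  obtain g M where g: "g \<in> L2" "integrable lebesgue g" "continuous_on UNIV g" "\<And>t. cmod (g t) \<le> M"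
      and gd: "L2_norm (\<lambda>t. g t - h t) < d"
    using L2_dense_continuous[OF h(2) d] by blast
  have gm: "g \<in> borel_measurable borel" using g(3) by (rule borel_measurable_continuous_onI)
  then have gi: "integrable lborel g" using g(2) by (simp add: integrable_completion)
  have "ennreal (2 * pi * (L2_norm g)\<^sup>2) \<le> ennreal ((L2_norm (fourier_L1 g))\<^sup>2)"
    using plancherel_ge_continuous[OF gi g(1,3,4)] L2_nn_integral[OF fourier_L1_L2(1)[OF g(2,1)]]
    by (simp add: nn_integral_completion)
  then have "(sqrt (2 * pi) * L2_norm g)\<^sup>2 \<le> (L2_norm (fourier_L1 g))\<^sup>2"
    by (simp add: power_mult_distrib)
  then have 1: "sqrt (2 * pi) * L2_norm g \<le> L2_norm (fourier_L1 g)"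
    by (rule power2_le_imp_le) (rule L2_norm_nonneg)
  have "\<bar>L2_norm (fourier_L1 g) - L2_norm (fourier_L1 h)\<bar> \<le> L2_norm (\<lambda>\<xi>. fourier_L1 g \<xi> - fourier_L1 h \<xi>)"
    by (intro L2_norm_diff_ge fourier_L1_L2(1) g h)
  also have "\<dots> = L2_norm (fourier_L1 (\<lambda>t. g t - h t))"
    by (rule arg_cong[of _ _ L2_norm]) (rule ext, rule fourier_L1_diff[OF g(2) h(1), symmetric])
  also have "\<dots> \<le> sqrt (2 * pi) * L2_norm (\<lambda>t. g t - h t)"
    by (intro fourier_L1_L2(2) L2_diff g h Bochner_Integration.integrable_diff)
  finally have 2: "L2_norm (fourier_L1 g) \<le> L2_norm (fourier_L1 h) + sqrt (2 * pi) * d"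
    using mult_left_mono[OF less_imp_le[OF gd] real_sqrt_ge_zero[of "2 * pi"]] pi_ge_zero by linarith
  have "L2_norm h \<le> L2_norm g + d"
    using L2_norm_diff_ge[OF g(1) h(2)] gd by simp
  then have "sqrt (2 * pi) * L2_norm h \<le> sqrt (2 * pi) * (L2_norm g + d)"
    by (intro mult_left_mono) auto
  also have "\<dots> \<le> L2_norm (fourier_L1 h) + 2 * (sqrt (2 * pi) * d)"
    using 1 2 unfolding distrib_left by linarith
  also have "2 * (sqrt (2 * pi) * d) = e" by (simp add: d_def)
  finally show "sqrt (2 * pi) * L2_norm h \<le> L2_norm (fourier_L1 h) + e" .
qed

section \<open>The Fourier transform on \<open>L\<^sup>2\<close> and integer translates\<close>

lemma L2_approx_L1:
  assumes "f \<in> L2"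
  obtains h where "\<And>n::nat. integrable lebesgue (h n)" "\<And>n. h n \<in> L2" "\<And>n. h n \<in> borel_measurable borel"
    "(\<lambda>n. L2_norm (\<lambda>t. h n t - f t)) \<longlonglongrightarrow> 0"
proof -
  have "\<exists>g. g \<in> L2 \<and> integrable lebesgue g \<and> continuous_on UNIV g \<and> L2_norm (\<lambda>t. g t - f t) < 1 / real (Suc n)" for n
    using L2_dense_continuous[OF assms, of "1 / real (Suc n)"] by (metis of_nat_0_less_iff zero_less_Suc zero_less_divide_1_iff)
  then obtain h where h: "h n \<in> L2" "integrable lebesgue (h n)" "continuous_on UNIV (h n)"
      "L2_norm (\<lambda>t. h n t - f t) < 1 / real (Suc n)" for n
    by metis
  have "(\<lambda>n. L2_norm (\<lambda>t. h n t - f t)) \<longlonglongrightarrow> 0"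
    by (rule Lim_null_comparison[OF _ LIMSEQ_Suc[OF lim_1_over_n]])
      (use h(4) L2_norm_nonneg in \<open>auto intro!: always_eventually less_imp_le\<close>)
  then show ?thesis using h(1,2) borel_measurable_continuous_onI[OF h(3)] by (intro that)
qed

lemma L2_norm_fourier_L1_diff:
  assumes "integrable lebesgue f" "f \<in> L2" "integrable lebesgue g" "g \<in> L2"
  shows "L2_norm (\<lambda>\<xi>. fourier_L1 f \<xi> - fourier_L1 g \<xi>) = sqrt (2 * pi) * L2_norm (\<lambda>t. f t - g t)"
proof -
  have "(\<lambda>\<xi>. fourier_L1 f \<xi> - fourier_L1 g \<xi>) = fourier_L1 (\<lambda>t. f t - g t)"
    using fourier_L1_diff[OF assms(1,3)] by auto
  then show ?thesis using assms by (simp only:) (intro plancherel L2_diff Bochner_Integration.integrable_diff)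
qed

text \<open>
By Plancherel the transforms of an approximating sequence form a Cauchy sequence, and any two
approximating sequences have transforms whose difference tends to zero.
\<close>

lemma fourier_L2_exists:
  assumes f: "f \<in> L2"
  shows "\<exists>g. g \<in> L2 \<and>
     (\<forall>h :: nat \<Rightarrow> real \<Rightarrow> complex.
        (\<forall>n. integrable lebesgue (h n) \<and> h n \<in> L2) \<and>
        (\<lambda>n. L2_norm (\<lambda>t. h n t - f t)) \<longlonglongrightarrow> 0 \<longrightarrow>
        (\<lambda>n. L2_norm (\<lambda>\<xi>. fourier_L1 (h n) \<xi> - g \<xi>)) \<longlonglongrightarrow> 0)"
proof -
  obtain h where hi: "\<And>n::nat. integrable lebesgue (h n)" and h2: "\<And>n. h n \<in> L2"
      and "\<And>n. h n \<in> borel_measurable borel"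
      and lim: "(\<lambda>n. L2_norm (\<lambda>t. h n t - f t)) \<longlonglongrightarrow> 0"
    using L2_approx_L1[OF f] by blast
  have F2: "fourier_L1 (h n) \<in> L2" for n by (intro fourier_L1_L2 hi h2)
  have C: "\<exists>N. \<forall>m\<ge>N. \<forall>n\<ge>N. L2_norm (\<lambda>\<xi>. fourier_L1 (h m) \<xi> - fourier_L1 (h n) \<xi>) < e" if e: "e > 0" for e
  proof -
    define d where "d = e / (2 * sqrt (2 * pi))"
    have d: "d > 0" using e by (simp add: d_def)
    then obtain N where N: "L2_norm (\<lambda>t. h n t - f t) < d" if "n \<ge> N" for n
      using order_tendstoD(2)[OF lim d] by (auto simp: eventually_sequentially)
    have "L2_norm (\<lambda>\<xi>. fourier_L1 (h m) \<xi> - fourier_L1 (h n) \<xi>) < e" if "m \<ge> N" "n \<ge> N" for m n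
    proof -
      have "L2_norm (\<lambda>t. h m t - h n t) < 2 * d"
        using L2_norm_triangle_diff[OF h2[of m] f h2[of n]] N[OF that(1)] N[OF that(2)]
        by (simp add: L2_norm_minus_commute[of f])
      then have "sqrt (2 * pi) * L2_norm (\<lambda>t. h m t - h n t) < sqrt (2 * pi) * (2 * d)"
        by (intro mult_strict_left_mono) auto
      also have "\<dots> = e" by (simp add: d_def)
      finally show ?thesis by (simp add: L2_norm_fourier_L1_diff hi h2)
    qed
    then show ?thesis by blast
  qed
  obtain g where g: "g \<in> L2" "(\<lambda>n. L2_norm (\<lambda>\<xi>. fourier_L1 (h n) \<xi> - g \<xi>)) \<longlonglongrightarrow> 0"
    by (rule L2_complete[OF F2 C])
  show ?thesis
  proof (intro exI conjI allI impI, rule g(1))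
    fix k :: "nat \<Rightarrow> real \<Rightarrow> complex"
    assume k: "(\<forall>n. integrable lebesgue (k n) \<and> k n \<in> L2) \<and> (\<lambda>n. L2_norm (\<lambda>t. k n t - f t)) \<longlonglongrightarrow> 0"
    have "L2_norm (\<lambda>\<xi>. fourier_L1 (k n) \<xi> - g \<xi>) \<le>
        sqrt (2 * pi) * (L2_norm (\<lambda>t. k n t - f t) + L2_norm (\<lambda>t. h n t - f t))
        + L2_norm (\<lambda>\<xi>. fourier_L1 (h n) \<xi> - g \<xi>)" (is "?a n \<le> ?b n") for n
    proof -
      have "?a n \<le> L2_norm (\<lambda>\<xi>. fourier_L1 (k n) \<xi> - fourier_L1 (h n) \<xi>) + L2_norm (\<lambda>\<xi>. fourier_L1 (h n) \<xi> - g \<xi>)"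
        using k by (intro L2_norm_triangle_diff F2 g fourier_L1_L2(1)) auto
      also have "L2_norm (\<lambda>\<xi>. fourier_L1 (k n) \<xi> - fourier_L1 (h n) \<xi>) = sqrt (2 * pi) * L2_norm (\<lambda>t. k n t - h n t)"
        using k by (intro L2_norm_fourier_L1_diff hi h2) auto
      also have "L2_norm (\<lambda>t. k n t - h n t) \<le> L2_norm (\<lambda>t. k n t - f t) + L2_norm (\<lambda>t. h n t - f t)"
        using L2_norm_triangle_diff[of "k n" f "h n"] k f h2 by (simp add: L2_norm_minus_commute[of f])
      finally show ?thesis by simp
    qed
    moreover have "?b \<longlonglongrightarrow> sqrt (2 * pi) * (0 + 0) + 0"
      using k by (intro tendsto_intros lim g) auto
    ultimately show "?a \<longlonglongrightarrow> 0"
      by (intro Lim_null_comparison[of ?a ?b]) (auto simp: L2_norm_nonneg)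
  qed
qed

lemma fourier_L2:
  assumes "f \<in> L2"
  shows "fourier_L2 f \<in> L2"
    and "\<lbrakk>\<And>n. integrable lebesgue (h n); \<And>n. h n \<in> L2; (\<lambda>n. L2_norm (\<lambda>t. h n t - f t)) \<longlonglongrightarrow> 0\<rbrakk>
      \<Longrightarrow> (\<lambda>n. L2_norm (\<lambda>\<xi>. fourier_L1 (h n) \<xi> - fourier_L2 f \<xi>)) \<longlonglongrightarrow> 0"
  using someI_ex[OF fourier_L2_exists[OF assms], folded fourier_L2_def] by blast+

definition trig_poly :: "(int \<Rightarrow> complex) \<Rightarrow> int set \<Rightarrow> real \<Rightarrow> complex" where
  "trig_poly d F \<xi> = (\<Sum>k\<in>F. d k * exp (- \<i> * complex_of_real (of_int k * \<xi>)))"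

lemma continuous_trig_poly: "continuous_on S (trig_poly d F)"
  unfolding trig_poly_def by (intro continuous_intros)

lemma borel_measurable_trig_poly [measurable]: "trig_poly d F \<in> borel_measurable borel"
  by (rule borel_measurable_continuous_onI[OF continuous_trig_poly])

lemma norm_trig_poly_le: "cmod (trig_poly d F \<xi>) \<le> (\<Sum>k\<in>F. cmod (d k))"
  unfolding trig_poly_def by (rule order_trans[OF norm_sum]) (simp add: norm_mult)

definition shift_sum :: "(int \<Rightarrow> complex) \<Rightarrow> int set \<Rightarrow> (real \<Rightarrow> complex) \<Rightarrow> real \<Rightarrow> complex" where
  "shift_sum d F f t = (\<Sum>k\<in>F. d k * f (t - of_int k))"

lemma L2_shift_sum:
  assumes "f \<in> L2"
  shows "shift_sum d F f \<in> L2" and "L2_norm (shift_sum d F f) \<le> (\<Sum>k\<in>F. cmod (d k)) * L2_norm f"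
proof -
  have s: "(\<lambda>t. d k * f (t - of_int k)) \<in> L2" for k by (intro L2_cmult L2_shift(1) assms)
  show 1: "shift_sum d F f \<in> L2" for F unfolding shift_sum_def[abs_def] by (intro L2_sum s)
  show "L2_norm (shift_sum d F f) \<le> (\<Sum>k\<in>F. cmod (d k)) * L2_norm f"
  proof (induction F rule: infinite_finite_induct)
    case (insert k F)
    have "L2_norm (\<lambda>t. d k * f (t - of_int k) + shift_sum d F f t)
      \<le> L2_norm (\<lambda>t. d k * f (t - of_int k)) + L2_norm (shift_sum d F f)"
      by (rule L2_norm_triangle[OF s 1])
    also have "L2_norm (\<lambda>t. d k * f (t - of_int k)) = cmod (d k) * L2_norm f"
      by (simp add: L2_norm_cmult L2_shift(2)[OF assms])
    finally show ?case using insert by (simp add: shift_sum_def[abs_def] distrib_right)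
  qed (simp_all add: shift_sum_def[abs_def])
qed

lemma fourier_L1_shift_sum:
  assumes h: "integrable lborel h"
  shows "fourier_L1 (shift_sum d F h) \<xi> = trig_poly d F \<xi> * fourier_L1 h \<xi>"
    and "integrable lborel (shift_sum d F h)"
proof -
  have hm[measurable]: "h \<in> borel_measurable borel" using h by auto
  have hs: "integrable lborel (\<lambda>t. h (t - s))" for s
    using lborel_integrable_real_affine[OF h, of 1 "-s"] by simp
  show si: "integrable lborel (shift_sum d F h)"
    unfolding shift_sum_def[abs_def] by (intro Bochner_Integration.integrable_sum integrable_mult_right hs)
  have shift: "(LINT t|lborel. h (t - s) * exp (- \<i> * complex_of_real (t * \<xi>)))
      = exp (- \<i> * complex_of_real (s * \<xi>)) * fourier_L1 h \<xi>" for s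
  proof -
    have E: "exp (- \<i> * complex_of_real ((s + t) * \<xi>)) = exp (- \<i> * complex_of_real (s * \<xi>)) * exp (- \<i> * complex_of_real (t * \<xi>))" for t
      unfolding exp_add[symmetric] by (simp add: algebra_simps)
    have e: "h (s + 1 * t - s) * exp (- \<i> * complex_of_real ((s + 1 * t) * \<xi>))
        = exp (- \<i> * complex_of_real (s * \<xi>)) * (h t * exp (- \<i> * complex_of_real (t * \<xi>)))" for t
      by (simp only: mult_1 add_diff_cancel_left' E[of t] mult.left_commute)
    have "(LINT t|lborel. h (t - s) * exp (- \<i> * complex_of_real (t * \<xi>)))
      = (LINT t|lborel. exp (- \<i> * complex_of_real (s * \<xi>)) * (h t * exp (- \<i> * complex_of_real (t * \<xi>))))"
      by (subst lborel_integral_real_affine[where c=1 and t=s]) (simp_all only: e, simp_all)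
    then show ?thesis by (simp add: fourier_L1_lborel)
  qed
  have "fourier_L1 (shift_sum d F h) \<xi>
      = (LINT t|lborel. (\<Sum>k\<in>F. d k * (h (t - of_int k) * exp (- \<i> * complex_of_real (t * \<xi>)))))"
    using si by (subst fourier_L1_lborel) (auto simp: shift_sum_def sum_distrib_right mult.assoc)
  also have "\<dots> = (\<Sum>k\<in>F. d k * (LINT t|lborel. h (t - of_int k) * exp (- \<i> * complex_of_real (t * \<xi>))))"
    by (subst Bochner_Integration.integral_sum)
      (intro integrable_mult_right integrable_fourier_kernel hs, simp)
  also have "\<dots> = trig_poly d F \<xi> * fourier_L1 h \<xi>"
    unfolding shift trig_poly_def sum_distrib_right by (simp only: mult.assoc)
  finally show "fourier_L1 (shift_sum d F h) \<xi> = trig_poly d F \<xi> * fourier_L1 h \<xi>" .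
qed

lemma trig_poly_mult_L2:
  assumes "f \<in> L2"
  shows "(\<lambda>\<xi>. trig_poly d F \<xi> * f \<xi>) \<in> L2"
    and "L2_norm (\<lambda>\<xi>. trig_poly d F \<xi> * f \<xi>) \<le> (\<Sum>k\<in>F. cmod (d k)) * L2_norm f"
proof -
  have "trig_poly d F \<in> borel_measurable lebesgue"
    by (intro measurable_completion) simp
  then have m: "(\<lambda>\<xi>. trig_poly d F \<xi> * f \<xi>) \<in> borel_measurable lebesgue"
    using L2_borel[OF assms] by (rule borel_measurable_times)
  have b: "cmod (trig_poly d F \<xi> * f \<xi>) \<le> (\<Sum>k\<in>F. cmod (d k)) * cmod (f \<xi>)" for \<xi>
    unfolding norm_mult by (intro mult_right_mono norm_trig_poly_le) simp
  show "(\<lambda>\<xi>. trig_poly d F \<xi> * f \<xi>) \<in> L2" by (rule L2_dominated[OF assms m b])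
  show "L2_norm (\<lambda>\<xi>. trig_poly d F \<xi> * f \<xi>) \<le> (\<Sum>k\<in>F. cmod (d k)) * L2_norm f"
    by (rule L2_norm_mult_bound[OF assms m b]) (simp add: sum_nonneg)
qed

text \<open>
On \<open>L\<^sup>1 \<inter> L\<^sup>2\<close> this is Plancherel applied to the sum of translates. Both sides are continuous for the
\<open>L\<^sup>2\<close> norm, as the trigonometric polynomial is bounded, so the identity passes to the limit.
\<close>

theorem L2_norm_shift_sum:
  assumes f: "f \<in> L2"
  shows "L2_norm (\<lambda>\<xi>. trig_poly d F \<xi> * fourier_L2 f \<xi>) = sqrt (2 * pi) * L2_norm (shift_sum d F f)"
proof -
  let ?C = "\<Sum>k\<in>F. cmod (d k)"
  obtain h where hi: "\<And>n::nat. integrable lebesgue (h n)" and h2: "\<And>n. h n \<in> L2"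
      and hb: "\<And>n. h n \<in> borel_measurable borel"
      and lim: "(\<lambda>n. L2_norm (\<lambda>t. h n t - f t)) \<longlonglongrightarrow> 0"
    using L2_approx_L1[OF f] by blast
  have hl: "integrable lborel (h n)" for n using hi hb by (simp add: integrable_completion)
  have Fi: "integrable lborel (shift_sum d F (h n))" for n by (rule fourier_L1_shift_sum(2)[OF hl])
  then have Fl: "integrable lebesgue (shift_sum d F (h n))" for n
    by (subst integrable_completion) auto
  have eq: "L2_norm (\<lambda>\<xi>. trig_poly d F \<xi> * fourier_L1 (h n) \<xi>) = sqrt (2 * pi) * L2_norm (shift_sum d F (h n))" for n
  proof -
    have "(\<lambda>\<xi>. trig_poly d F \<xi> * fourier_L1 (h n) \<xi>) = fourier_L1 (shift_sum d F (h n))"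
      using fourier_L1_shift_sum(1)[OF hl] by auto
    then show ?thesis by (simp only:) (intro plancherel Fl L2_shift_sum(1) h2)
  qed
  have "(\<lambda>n. L2_norm (shift_sum d F (h n))) \<longlonglongrightarrow> L2_norm (shift_sum d F f)"
  proof (rule L2_norm_tendsto[OF L2_shift_sum(1)[OF f] L2_shift_sum(1)[OF h2] Lim_null_comparison])
    show "\<forall>\<^sub>F n in sequentially. norm (L2_norm (\<lambda>t. shift_sum d F (h n) t - shift_sum d F f t)) \<le> ?C * L2_norm (\<lambda>t. h n t - f t)"
    proof (intro always_eventually allI)
      fix n
      have "(\<lambda>t. shift_sum d F (h n) t - shift_sum d F f t) = shift_sum d F (\<lambda>t. h n t - f t)"
        by (auto simp: shift_sum_def sum_subtractf right_diff_distrib)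
      then show "norm (L2_norm (\<lambda>t. shift_sum d F (h n) t - shift_sum d F f t)) \<le> ?C * L2_norm (\<lambda>t. h n t - f t)"
        using L2_shift_sum(2)[OF L2_diff[OF h2 f]] by (simp add: L2_norm_nonneg)
    qed
    show "(\<lambda>n. ?C * L2_norm (\<lambda>t. h n t - f t)) \<longlonglongrightarrow> 0"
      using tendsto_mult_right_zero[OF lim] by simp
  qed
  then have "(\<lambda>n. sqrt (2 * pi) * L2_norm (shift_sum d F (h n))) \<longlonglongrightarrow> sqrt (2 * pi) * L2_norm (shift_sum d F f)"
    by (intro tendsto_intros)
  moreover have "(\<lambda>n. L2_norm (\<lambda>\<xi>. trig_poly d F \<xi> * fourier_L1 (h n) \<xi>)) \<longlonglongrightarrow> L2_norm (\<lambda>\<xi>. trig_poly d F \<xi> * fourier_L2 f \<xi>)"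
  proof (rule L2_norm_tendsto[OF _ _ Lim_null_comparison])
    have F2: "fourier_L1 (h n) \<in> L2" for n by (intro fourier_L1_L2 hi h2)
    show "(\<lambda>\<xi>. trig_poly d F \<xi> * fourier_L2 f \<xi>) \<in> L2" by (intro trig_poly_mult_L2 fourier_L2 f)
    show "(\<lambda>\<xi>. trig_poly d F \<xi> * fourier_L1 (h n) \<xi>) \<in> L2" for n by (intro trig_poly_mult_L2 F2)
    show "\<forall>\<^sub>F n in sequentially. norm (L2_norm (\<lambda>\<xi>. trig_poly d F \<xi> * fourier_L1 (h n) \<xi> - trig_poly d F \<xi> * fourier_L2 f \<xi>))
        \<le> ?C * L2_norm (\<lambda>\<xi>. fourier_L1 (h n) \<xi> - fourier_L2 f \<xi>)"
      using trig_poly_mult_L2(2)[OF L2_diff[OF F2 fourier_L2(1)[OF f]]]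
      by (intro always_eventually allI) (simp add: L2_norm_nonneg right_diff_distrib)
    show "(\<lambda>n. ?C * L2_norm (\<lambda>\<xi>. fourier_L1 (h n) \<xi> - fourier_L2 f \<xi>)) \<longlonglongrightarrow> 0"
      by (intro tendsto_mult_right_zero fourier_L2(2)[OF f hi h2 lim])
  qed
  ultimately show ?thesis unfolding eq by (rule LIMSEQ_unique[rotated])
qed

section \<open>Periodization and trigonometric polynomials\<close>

text \<open>
Enumerating the integers gives access to the countable additivity of the integral, which is
formulated for sums over \<open>nat\<close>.
\<close>

lemma infsum_int_ennreal:
  fixes f :: "int \<Rightarrow> ennreal"
  shows "infsum f UNIV = (\<Sum>n. f (int_decode n))"
proof -
  have "infsum f UNIV = infsum (\<lambda>n. f (int_decode n)) UNIV"
    by (rule infsum_reindex_bij_betw[OF bij_int_decode, symmetric])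
  also have "\<dots> = (\<Sum>n. f (int_decode n))"
    by (rule sums_unique[OF has_sum_imp_sums[OF has_sum_infsum]]) (simp add: nonneg_summable_on_complete)
  finally show ?thesis .
qed

definition periodization :: "(real \<Rightarrow> complex) \<Rightarrow> real \<Rightarrow> ennreal" where
  "periodization g \<xi> = (\<Sum>\<^sub>\<infinity>k::int. ennreal ((cmod (g (\<xi> + 2 * of_int k * pi)))\<^sup>2))"

lemma periodization_periodic: "periodization g (\<xi> + 2 * of_int m * pi) = periodization g \<xi>"
proof -
  have "periodization g \<xi> = (\<Sum>\<^sub>\<infinity>k::int. ennreal ((cmod (g (\<xi> + 2 * of_int (m + k) * pi)))\<^sup>2))"
    unfolding periodization_def
    by (rule infsum_reindex_bij_betw[of "\<lambda>k. m + k", symmetric]) (simp add: bij_plus_right)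
  then show ?thesis by (simp add: periodization_def algebra_simps)
qed

lemma borel_measurable_periodization [measurable]:
  assumes "g \<in> borel_measurable borel"
  shows "periodization g \<in> borel_measurable borel"
proof -
  note [measurable] = assms
  show ?thesis unfolding periodization_def[abs_def] infsum_int_ennreal by measurable
qed

text \<open>
The intervals of length \<open>2\<pi>\<close> starting at the multiples of \<open>2\<pi>\<close> tile the line, and each of them is translated
back to the first one.
\<close>

lemma nn_integral_periodization:
  assumes [measurable]: "u \<in> borel_measurable borel" "g \<in> borel_measurable borel"
    and per: "\<And>\<xi> k. u (\<xi> + 2 * of_int k * pi) = u \<xi>"
  shows "(\<integral>\<^sup>+\<xi>. u \<xi> * ennreal ((cmod (g \<xi>))\<^sup>2) \<partial>lborel)
    = (\<integral>\<^sup>+\<xi>. u \<xi> * periodization g \<xi> * indicator {0..<2*pi} \<xi> \<partial>lborel)"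
proof -
  let ?c = "\<lambda>n. 2 * of_int (int_decode n) * pi"
  let ?f = "\<lambda>\<xi>. u \<xi> * ennreal ((cmod (g \<xi>))\<^sup>2)"
  let ?i = "indicator {0..<2*pi} :: real \<Rightarrow> ennreal"
  have "(\<integral>\<^sup>+\<xi>. u \<xi> * periodization g \<xi> * ?i \<xi> \<partial>lborel) = (\<integral>\<^sup>+\<xi>. (\<Sum>n. ?f (\<xi> + ?c n) * ?i \<xi>) \<partial>lborel)"
    unfolding periodization_def infsum_int_ennreal
    by (simp only: ennreal_suminf_cmult ennreal_suminf_multc per)
  also have "\<dots> = (\<Sum>n. \<integral>\<^sup>+\<xi>. ?f (\<xi> + ?c n) * ?i \<xi> \<partial>lborel)"
    by (intro nn_integral_suminf) measurable
  also have "\<dots> = (\<Sum>n. \<integral>\<^sup>+\<xi>. ?f \<xi> * ?i (\<xi> - ?c n) \<partial>lborel)"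
  proof (intro suminf_cong)
    fix n
    show "(\<integral>\<^sup>+\<xi>. ?f (\<xi> + ?c n) * ?i \<xi> \<partial>lborel) = (\<integral>\<^sup>+\<xi>. ?f \<xi> * ?i (\<xi> - ?c n) \<partial>lborel)"
      by (subst nn_integral_real_affine[where c=1 and t="?c n"]) (simp_all add: add.commute)
  qed
  also have "\<dots> = (\<integral>\<^sup>+\<xi>. (\<Sum>n. ?f \<xi> * ?i (\<xi> - ?c n)) \<partial>lborel)"
    by (intro nn_integral_suminf[symmetric]) measurable
  also have "\<dots> = (\<integral>\<^sup>+\<xi>. ?f \<xi> \<partial>lborel)"
  proof (intro nn_integral_cong)
    fix \<xi> :: real
    define m where "m = \<lfloor>\<xi> / (2 * pi)\<rfloor>"
    \<comment> \<open>Each point lies in exactly one tile, namely the one whose index is \<open>m\<close>.\<close>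
    have iff: "\<xi> - 2 * of_int k * pi \<in> {0..<2*pi} \<longleftrightarrow> k = m" for k
    proof -
      have "\<xi> - 2 * of_int k * pi \<in> {0..<2*pi} \<longleftrightarrow> of_int k \<le> \<xi> / (2 * pi) \<and> \<xi> / (2 * pi) < of_int k + 1"
        by (simp add: field_simps)
      also have "\<dots> \<longleftrightarrow> k = m" unfolding m_def floor_eq_iff[symmetric] by auto
      finally show ?thesis .
    qed
    have "(\<Sum>n. ?i (\<xi> - ?c n)) = (\<Sum>n\<in>{int_encode m}. ?i (\<xi> - ?c n))"
      using iff by (intro suminf_finite) (auto simp: indicator_def)
    also have "\<dots> = 1" using iff[of m] by simp
    finally have "(\<Sum>n. ?i (\<xi> - ?c n)) = 1" .
    then show "(\<Sum>n. ?f \<xi> * ?i (\<xi> - ?c n)) = ?f \<xi>" by simp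
  qed
  finally show ?thesis ..
qed

lemma trig_poly_periodic: "trig_poly d F (\<xi> + 2 * of_int k * pi) = trig_poly d F \<xi>"
proof -
  have "exp (- \<i> * complex_of_real (of_int j * (\<xi> + 2 * of_int k * pi))) = exp (- \<i> * complex_of_real (of_int j * \<xi>))" for j :: int
    unfolding exp_eq by (rule exI[of _ "- j * k"]) (simp add: algebra_simps)
  then show ?thesis by (simp only: trig_poly_def)
qed

lemma character_integral:
  "(LINT \<xi>|lborel. indicator {0..2*pi} \<xi> *\<^sub>R exp (- \<i> * complex_of_real (of_int k * \<xi>))) = (if k = 0 then 2 * pi else 0)"
proof (cases "k = 0")
  case True
  then show ?thesis by (simp add: scaleR_conv_of_real)
next
  case False
  let ?F = "\<lambda>\<xi>::real. \<i> / of_int k * exp (- \<i> * complex_of_real (of_int k * \<xi>))"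
  have "(LINT \<xi>|lborel. indicator {0..2*pi} \<xi> *\<^sub>R exp (- \<i> * complex_of_real (of_int k * \<xi>))) = ?F (2 * pi) - ?F 0"
  proof (rule integral_FTC_Icc)
    fix x :: real
    have "((\<lambda>z. \<i> / of_int k * exp (- \<i> * (of_int k * z))) has_field_derivative exp (- \<i> * (of_int k * complex_of_real x))) (at (complex_of_real x))"
      using False by (auto intro!: derivative_eq_intros)
    from has_vector_derivative_real_field[OF this]
    show "(?F has_vector_derivative exp (- \<i> * complex_of_real (of_int k * x))) (at x within {0..2*pi})"
      by (simp add: has_vector_derivative_at_within)
  qed (auto intro!: continuous_intros)
  also have "?F (2 * pi) = ?F 0"
  proof -
    have "exp (- \<i> * complex_of_real (of_int k * (2 * pi))) = exp 0"
      unfolding exp_eq by (rule exI[of _ "- k"]) (simp add: algebra_simps)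
    then show ?thesis by simp
  qed
  finally show ?thesis using False by simp
qed

text \<open>
Orthogonality of the characters. The half-open interval is the fundamental domain used by the tiling above;
the continuous integrand is first integrated over its closure.
\<close>

lemma trig_poly_parseval:
  assumes "finite F"
  shows "(\<integral>\<^sup>+\<xi>. ennreal ((cmod (trig_poly d F \<xi>))\<^sup>2) * indicator {0..<2*pi} \<xi> \<partial>lborel) = ennreal (2 * pi * (\<Sum>k\<in>F. (cmod (d k))\<^sup>2))"
proof -
  let ?e = "\<lambda>k \<xi>. exp (- \<i> * complex_of_real (of_int k * \<xi>))"
  let ?h = "\<lambda>\<xi>. indicator {0..2*pi} \<xi> * (cmod (trig_poly d F \<xi>))\<^sup>2 :: real"
  have ei: "integrable lborel (\<lambda>\<xi>. indicator {0..2*pi} \<xi> *\<^sub>R ?e k \<xi>)" for k :: int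
    by (rule borel_integrable_compact) (auto intro!: continuous_intros)
  have "set_integrable lborel {0..2*pi} (\<lambda>\<xi>. (cmod (trig_poly d F \<xi>))\<^sup>2)"
    unfolding set_integrable_def
    by (rule borel_integrable_compact) (auto intro!: continuous_intros continuous_trig_poly)
  then have hi: "integrable lborel ?h" by (simp add: set_integrable_def)
  have "complex_of_real (LINT \<xi>|lborel. ?h \<xi>) =
     (LINT \<xi>|lborel. (\<Sum>k\<in>F. \<Sum>l\<in>F. d k * cnj (d l) * (indicator {0..2*pi} \<xi> *\<^sub>R ?e (k - l) \<xi>)))"
    unfolding integral_complex_of_real[symmetric]
  proof (intro Bochner_Integration.integral_cong refl)
    fix \<xi>
    have e: "?e k \<xi> * cnj (?e l \<xi>) = ?e (k - l) \<xi>" for k l :: int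
      by (simp add: exp_cnj exp_add[symmetric] algebra_simps exp_diff[symmetric])
    have "complex_of_real ((cmod (trig_poly d F \<xi>))\<^sup>2) = trig_poly d F \<xi> * cnj (trig_poly d F \<xi>)"
      by (rule complex_norm_square)
    also have "\<dots> = (\<Sum>k\<in>F. \<Sum>l\<in>F. (d k * ?e k \<xi>) * cnj (d l * ?e l \<xi>))"
      unfolding trig_poly_def cnj_sum by (rule sum_product)
    also have "\<dots> = (\<Sum>k\<in>F. \<Sum>l\<in>F. d k * cnj (d l) * ?e (k - l) \<xi>)"
    proof (intro sum.cong refl)
      have "(a * x) * cnj (b * y) = a * cnj b * (x * cnj y)" for a b x y
        by simp
      then show "(d k * ?e k \<xi>) * cnj (d l * ?e l \<xi>) = d k * cnj (d l) * ?e (k - l) \<xi>" for k l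
        by (simp only: e)
    qed
    finally have *: "complex_of_real ((cmod (trig_poly d F \<xi>))\<^sup>2) = (\<Sum>k\<in>F. \<Sum>l\<in>F. d k * cnj (d l) * ?e (k - l) \<xi>)" .
    show "complex_of_real (?h \<xi>) = (\<Sum>k\<in>F. \<Sum>l\<in>F. d k * cnj (d l) * (indicator {0..2*pi} \<xi> *\<^sub>R ?e (k - l) \<xi>))"
      unfolding of_real_mult * by (simp add: indicator_def)
  qed
  also have "\<dots> = (\<Sum>k\<in>F. \<Sum>l\<in>F. d k * cnj (d l) * (LINT \<xi>|lborel. indicator {0..2*pi} \<xi> *\<^sub>R ?e (k - l) \<xi>))"
    by (simp only: Bochner_Integration.integral_sum Bochner_Integration.integrable_sum integrable_mult_right ei integral_mult_right_zero)
  also have "\<dots> = (\<Sum>k\<in>F. \<Sum>l\<in>F. if k = l then 2 * pi * complex_of_real ((cmod (d k))\<^sup>2) else 0)"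
    unfolding character_integral by (intro sum.cong refl) (auto simp: complex_norm_square simp del: of_real_power)
  also have "\<dots> = complex_of_real (2 * pi * (\<Sum>k\<in>F. (cmod (d k))\<^sup>2))"
    using assms by (simp add: sum_distrib_left)
  finally have "(LINT \<xi>|lborel. ?h \<xi>) = 2 * pi * (\<Sum>k\<in>F. (cmod (d k))\<^sup>2)"
    by (simp only: of_real_eq_iff)
  then have "(\<integral>\<^sup>+\<xi>. ennreal (?h \<xi>) \<partial>lborel) = ennreal (2 * pi * (\<Sum>k\<in>F. (cmod (d k))\<^sup>2))"
    using nn_integral_eq_integral[OF hi] by simp
  moreover have "(\<integral>\<^sup>+\<xi>. ennreal ((cmod (trig_poly d F \<xi>))\<^sup>2) * indicator {0..<2*pi} \<xi> \<partial>lborel) = (\<integral>\<^sup>+\<xi>. ennreal (?h \<xi>) \<partial>lborel)"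
    by (intro nn_integral_cong_AE, use AE_lborel_singleton[of "2*pi"] in eventually_elim) (auto simp: indicator_def)
  ultimately show ?thesis by simp
qed

definition is_trig_poly :: "(real \<Rightarrow> complex) \<Rightarrow> bool" where
  "is_trig_poly f \<longleftrightarrow> (\<exists>d F. finite F \<and> f = trig_poly d F)"

lemma is_trig_poly_monom: "is_trig_poly (\<lambda>\<xi>. c * exp (- \<i> * complex_of_real (of_int k * \<xi>)))"
  unfolding is_trig_poly_def
  by (intro exI[of _ "\<lambda>_. c"] exI[of _ "{k}"]) (simp add: trig_poly_def fun_eq_iff)

lemma is_trig_poly_add:
  assumes "is_trig_poly f" "is_trig_poly g"
  shows "is_trig_poly (\<lambda>\<xi>. f \<xi> + g \<xi>)"
proof -
  obtain d F d' F' where *: "finite F" "f = trig_poly d F" "finite F'" "g = trig_poly d' F'"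
    using assms unfolding is_trig_poly_def by blast
  let ?e = "\<lambda>k \<xi>. exp (- \<i> * complex_of_real (of_int k * \<xi>))"
  let ?d = "\<lambda>k. (if k \<in> F then d k else 0)" and ?d' = "\<lambda>k. (if k \<in> F' then d' k else 0)"
  have "f \<xi> + g \<xi> = trig_poly (\<lambda>k. ?d k + ?d' k) (F \<union> F') \<xi>" for \<xi>
  proof -
    have "f \<xi> = (\<Sum>k\<in>F \<union> F'. ?d k * ?e k \<xi>)"
      unfolding *(2) trig_poly_def using *(1,3) by (intro sum.mono_neutral_cong_left) auto
    moreover have "g \<xi> = (\<Sum>k\<in>F \<union> F'. ?d' k * ?e k \<xi>)"
      unfolding *(4) trig_poly_def using *(1,3) by (intro sum.mono_neutral_cong_left) auto
    ultimately show ?thesis by (simp only: trig_poly_def sum.distrib distrib_right)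
  qed
  then show ?thesis unfolding is_trig_poly_def using *(1,3) by (intro exI[of _ "\<lambda>k. ?d k + ?d' k"] exI[of _ "F \<union> F'"]) auto
qed

lemma is_trig_poly_sum: "(\<And>k. k \<in> F \<Longrightarrow> is_trig_poly (f k)) \<Longrightarrow> is_trig_poly (\<lambda>\<xi>. \<Sum>k\<in>F. f k \<xi>)"
  by (induction F rule: infinite_finite_induct)
    (use is_trig_poly_monom[of 0 0] in \<open>auto intro: is_trig_poly_add\<close>)

lemma is_trig_poly_mult:
  assumes "is_trig_poly f" "is_trig_poly g"
  shows "is_trig_poly (\<lambda>\<xi>. f \<xi> * g \<xi>)"
proof -
  obtain d F d' F' where *: "finite F" "f = trig_poly d F" "finite F'" "g = trig_poly d' F'"
    using assms unfolding is_trig_poly_def by blast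
  let ?e = "\<lambda>k \<xi>. exp (- \<i> * complex_of_real (of_int k * \<xi>))"
  have "?e k \<xi> * ?e l \<xi> = ?e (k + l) \<xi>" for k l :: int and \<xi>
    by (simp add: exp_add[symmetric] algebra_simps)
  then have "(d k * ?e k \<xi>) * (d' l * ?e l \<xi>) = (d k * d' l) * ?e (k + l) \<xi>" for k l \<xi>
    by (metis (no_types, lifting) mult.assoc mult.left_commute)
  then have "(\<lambda>\<xi>. f \<xi> * g \<xi>) = (\<lambda>\<xi>. \<Sum>k\<in>F. \<Sum>l\<in>F'. (d k * d' l) * ?e (k + l) \<xi>)"
    unfolding *(2,4) trig_poly_def sum_product by (simp only:)
  then show ?thesis by (simp only:) (intro is_trig_poly_sum is_trig_poly_monom)
qed

text \<open>
This connects Stone-Weierstrass on the unit circle of the complex plane, which provides polynomials in the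
real coordinates, with trigonometric polynomials.
\<close>

lemma is_trig_poly_real_polynomial_function:
  assumes "real_polynomial_function p"
  shows "is_trig_poly (\<lambda>\<xi>. complex_of_real (p (cis \<xi>)))"
  using assms
proof (induction p rule: real_polynomial_function.induct)
  case (linear f)
  interpret bounded_linear f by fact
  have "complex_of_real (f (cis \<xi>)) =
      (f 1 / 2 + f \<i> * \<i> / 2) * exp (- \<i> * complex_of_real (of_int 1 * \<xi>))
    + (f 1 / 2 - f \<i> * \<i> / 2) * exp (- \<i> * complex_of_real (of_int (-1) * \<xi>))" for \<xi>
  proof -
    have "cis \<xi> = cos \<xi> *\<^sub>R 1 + sin \<xi> *\<^sub>R \<i>" by (simp add: complex_eq_iff)
    then have "f (cis \<xi>) = cos \<xi> * f 1 + sin \<xi> * f \<i>" by (simp add: add scaleR)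
    moreover have "exp (- \<i> * complex_of_real (of_int 1 * \<xi>)) = cos \<xi> - \<i> * sin \<xi>"
      "exp (- \<i> * complex_of_real (of_int (-1) * \<xi>)) = cos \<xi> + \<i> * sin \<xi>"
      using cis_conv_exp[of "-\<xi>"] cis_conv_exp[of "\<xi>"] by (simp_all add: complex_eq_iff)
    ultimately show ?thesis by (simp add: complex_eq_iff algebra_simps)
  qed
  then show ?case by (simp only:) (intro is_trig_poly_add is_trig_poly_monom)
next
  case (const c)
  show ?case using is_trig_poly_monom[of c 0] by simp
next
  case (add f g)
  then show ?case by (simp add: is_trig_poly_add)
next
  case (mult f g)
  then show ?case by (simp add: is_trig_poly_mult)
qed

section \<open>Positivity tested against trigonometric polynomials\<close>

text \<open>
A nonnegative continuous function on the circle is a uniform limit of squares of real trigonometric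
polynomials: approximate its square root and square the approximation.
\<close>

lemma integral_circle_continuous_nonneg:
  fixes u :: "complex \<Rightarrow> real"
  assumes W: "integrable lborel W"
    and pos: "\<And>d F. finite F \<Longrightarrow> 0 \<le> (LINT \<xi>|lborel. (cmod (trig_poly d F \<xi>))\<^sup>2 * W \<xi>)"
    and u: "continuous_on (sphere 0 1) u" "\<And>z. z \<in> sphere 0 1 \<Longrightarrow> 0 \<le> u z \<and> u z \<le> 1"
  shows "0 \<le> (LINT \<xi>|lborel. u (cis \<xi>) * W \<xi>)"
proof -
  have [measurable]: "W \<in> borel_measurable borel" using W by auto
  have cis: "cis \<xi> \<in> sphere 0 1" for \<xi> by simp
  have "\<exists>p. real_polynomial_function p \<and> (\<forall>z\<in>sphere 0 1. \<bar>sqrt (u z) - p z\<bar> < 1 / real (Suc n))" for n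
    by (rule Stone_Weierstrass_real_polynomial_function[of "sphere (0::complex) 1" "\<lambda>z. sqrt (u z)" "1 / real (Suc n)"])
      (auto intro!: continuous_intros u(1))
  then obtain p where p: "real_polynomial_function (p n)"
      "\<And>z. z \<in> sphere 0 1 \<Longrightarrow> \<bar>sqrt (u z) - p n z\<bar> < 1 / real (Suc n)" for n
    by metis
  have pc: "(\<lambda>\<xi>. p n (cis \<xi>)) \<in> borel_measurable borel" for n
    using continuous_on_compose2[OF continuous_on_polymonial_function[OF p(1)[unfolded real_polynomial_function_eq]] continuous_on_cis]
    by (auto intro!: borel_measurable_continuous_onI continuous_intros)
  have lim: "(\<lambda>n. (p n (cis \<xi>))\<^sup>2) \<longlonglongrightarrow> u (cis \<xi>)" for \<xi>
  proof -
    have "(\<lambda>n. p n (cis \<xi>) - sqrt (u (cis \<xi>))) \<longlonglongrightarrow> 0"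
      by (rule Lim_null_comparison[OF _ LIMSEQ_Suc[OF lim_1_over_n]])
        (use p(2)[OF cis] in \<open>auto intro!: always_eventually less_imp_le simp: abs_minus_commute\<close>)
    then have "(\<lambda>n. p n (cis \<xi>)) \<longlonglongrightarrow> sqrt (u (cis \<xi>))" by (simp add: LIM_zero_iff)
    from tendsto_power[OF this, of 2] show ?thesis using u(2)[OF cis] by simp
  qed
  have bd: "(p n (cis \<xi>))\<^sup>2 \<le> 4" for n \<xi>
  proof -
    have "\<bar>sqrt (u (cis \<xi>))\<bar> \<le> 1" using u(2)[OF cis, of \<xi>] by simp
    moreover have "1 / real (Suc n) \<le> 1" by simp
    ultimately have "\<bar>p n (cis \<xi>)\<bar> \<le> 2" using p(2)[OF cis, of \<xi> n] by linarith
    from power_mono[OF this, of 2] show ?thesis by simp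
  qed
  have "(\<lambda>n. LINT \<xi>|lborel. (p n (cis \<xi>))\<^sup>2 * W \<xi>) \<longlonglongrightarrow> (LINT \<xi>|lborel. u (cis \<xi>) * W \<xi>)"
  proof (rule integral_dominated_convergence[where w="\<lambda>\<xi>. 4 * \<bar>W \<xi>\<bar>"])
    show "integrable lborel (\<lambda>\<xi>. 4 * \<bar>W \<xi>\<bar>)" using W by simp
    show "AE \<xi> in lborel. (\<lambda>n. (p n (cis \<xi>))\<^sup>2 * W \<xi>) \<longlonglongrightarrow> u (cis \<xi>) * W \<xi>"
      by (intro AE_I2 tendsto_intros lim)
    show "AE \<xi> in lborel. norm ((p n (cis \<xi>))\<^sup>2 * W \<xi>) \<le> 4 * \<bar>W \<xi>\<bar>" for n
      using bd by (intro AE_I2) (simp add: abs_mult mult_right_mono)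
    have "(\<lambda>\<xi>. u (cis \<xi>)) \<in> borel_measurable borel"
      by (rule borel_measurable_LIMSEQ_metric[of "\<lambda>n \<xi>. (p n (cis \<xi>))\<^sup>2"]) (use pc lim in auto)
    then show "(\<lambda>\<xi>. u (cis \<xi>) * W \<xi>) \<in> borel_measurable lborel" by measurable
    show "(\<lambda>\<xi>. (p n (cis \<xi>))\<^sup>2 * W \<xi>) \<in> borel_measurable lborel" for n
      using pc[of n] by measurable
  qed
  moreover have "0 \<le> (LINT \<xi>|lborel. (p n (cis \<xi>))\<^sup>2 * W \<xi>)" for n
  proof -
    obtain d F where dF: "finite F" "(\<lambda>\<xi>. complex_of_real (p n (cis \<xi>))) = trig_poly d F"
      using is_trig_poly_real_polynomial_function[OF p(1)] unfolding is_trig_poly_def by blast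
    have "(p n (cis \<xi>))\<^sup>2 = (cmod (trig_poly d F \<xi>))\<^sup>2" for \<xi>
      using fun_cong[OF dF(2), of \<xi>, symmetric] by simp
    then show ?thesis using pos[OF dF(1), of d] by simp
  qed
  ultimately show ?thesis by (intro LIMSEQ_le_const) auto
qed

text \<open>
A function on the line is carried to the circle through the angle, which jumps at \<open>1\<close>. The extra factor
vanishes there and restores continuity; as \<open>c\<close> grows it tends to \<open>1\<close> at every other point.
\<close>

lemma continuous_on_circle_lift:
  assumes G: "continuous_on UNIV (G :: real \<Rightarrow> real)" and b: "\<And>x. \<bar>G x\<bar> \<le> 1"
  shows "continuous_on (sphere 0 1) (\<lambda>z. min 1 (c * cmod (z - 1)) * G (Arg2pi z))"
proof (intro continuous_at_imp_continuous_on ballI)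
  fix z :: complex assume z: "z \<in> sphere 0 1"
  show "isCont (\<lambda>z. min 1 (c * cmod (z - 1)) * G (Arg2pi z)) z"
  proof (cases "z = 1")
    case True
    have "((\<lambda>z. min 1 (c * cmod (z - 1)) * G (Arg2pi z)) \<longlongrightarrow> 0) (at 1)"
    proof (rule Lim_null_comparison)
      show "\<forall>\<^sub>F z in at 1. norm (min 1 (c * cmod (z - 1)) * G (Arg2pi z)) \<le> \<bar>min 1 (c * cmod (z - 1))\<bar>"
        using b by (intro always_eventually allI) (simp add: abs_mult mult_left_le)
      have "((\<lambda>z. \<bar>min 1 (c * cmod (z - 1))\<bar>) \<longlongrightarrow> \<bar>min 1 (c * cmod (1 - 1))\<bar>) (at (1::complex))"
        by (intro tendsto_intros)
      then show "((\<lambda>z. \<bar>min 1 (c * cmod (z - 1))\<bar>) \<longlongrightarrow> 0) (at (1::complex))" by simp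
    qed
    then show ?thesis using True by (simp add: isCont_def)
  next
    case False
    have "z \<notin> \<real>\<^sub>\<ge>\<^sub>0"
    proof
      assume "z \<in> \<real>\<^sub>\<ge>\<^sub>0"
      then have "z = of_real (Re z)" "Re z \<ge> 0" by (auto elim: nonneg_Reals_cases)
      then have "cmod z = Re z" by (metis abs_of_nonneg norm_of_real)
      with z \<open>z = of_real (Re z)\<close> False show False by simp
    qed
    then have "isCont Arg2pi z" by (rule continuous_at_Arg2pi)
    then have "isCont (\<lambda>z. G (Arg2pi z)) z"
      using G by (intro isCont_o2[of z Arg2pi G]) (simp_all add: continuous_on_eq_continuous_at)
    then show ?thesis by (intro continuous_intros)
  qed
qed

text \<open>
The indicator of the set where \<open>W\<close> is negative is an almost everywhere limit of continuous functions with
values between \<open>0\<close> and \<open>1\<close>, and after the correction above these live on the circle. Hence the integral of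
\<open>W\<close> over this set is nonnegative, which is possible only if the set is null.
\<close>

lemma AE_nonneg_if_trig_poly_integrals_nonneg:
  assumes W: "integrable lborel W"
    and pos: "\<And>d F. finite F \<Longrightarrow> 0 \<le> (LINT \<xi>|lborel. (cmod (trig_poly d F \<xi>))\<^sup>2 * W \<xi>)"
    and supp: "\<And>\<xi>. \<xi> \<notin> {0<..<2*pi} \<Longrightarrow> W \<xi> = 0"
  shows "AE \<xi> in lborel. 0 \<le> W \<xi>"
proof -
  have Wm[measurable]: "W \<in> borel_measurable borel" using W by auto
  define v :: "real \<Rightarrow> real" where "v \<xi> = (if W \<xi> < 0 then 1 else 0)" for \<xi>
  have vm[measurable]: "v \<in> borel_measurable borel" unfolding v_def by measurable
  then have "v measurable_on UNIV"
    by (intro lebesgue_measurable_imp_measurable_on measurable_completion) auto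
  then obtain N g where N: "negligible N" and g: "\<And>n::nat. continuous_on UNIV (g n)"
      and glim: "\<And>\<xi>. \<xi> \<notin> N \<Longrightarrow> (\<lambda>n. g n \<xi>) \<longlonglongrightarrow> v \<xi>"
    unfolding measurable_on_def by auto
  define G where "G n \<xi> = max 0 (min 1 (g n \<xi>))" for n \<xi>
  have Gc: "continuous_on UNIV (G n)" for n unfolding G_def by (intro continuous_intros g)
  have Gb: "0 \<le> G n \<xi>" "G n \<xi> \<le> 1" "\<bar>G n \<xi>\<bar> \<le> 1" for n \<xi> by (auto simp: G_def)
  define u where "u n z = min 1 (real n * cmod (z - 1)) * G n (Arg2pi z)" for n z
  have uc: "continuous_on (sphere 0 1) (u n)" for n
    unfolding u_def by (rule continuous_on_circle_lift[OF Gc Gb(3)])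
  have ub: "0 \<le> u n z" "u n z \<le> 1" for n z
    unfolding u_def using Gb(1,2)[of n] by (auto intro!: mult_le_one mult_nonneg_nonneg)
  have ulim: "(\<lambda>n. u n (cis \<xi>)) \<longlonglongrightarrow> v \<xi>" if \<xi>: "\<xi> \<in> {0<..<2*pi}" "\<xi> \<notin> N" for \<xi>
  proof -
    have arg: "Arg2pi (cis \<xi>) = \<xi>"
      using \<xi> by (intro Arg2pi_unique[of 1]) (auto simp: cis_conv_exp)
    have "cis \<xi> \<noteq> 1"
      using \<xi> arg Arg2pi_of_real[of 1] by auto
    then have c: "cmod (cis \<xi> - 1) > 0" by simp
    have "(\<lambda>n. min 1 (real n * cmod (cis \<xi> - 1))) \<longlonglongrightarrow> 1"
    proof (intro tendsto_eventually eventually_sequentiallyI)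
      fix n assume "nat \<lceil>1 / cmod (cis \<xi> - 1)\<rceil> \<le> n"
      then have "1 / cmod (cis \<xi> - 1) \<le> real n" by linarith
      then show "min 1 (real n * cmod (cis \<xi> - 1)) = 1" using c by (simp add: divide_le_eq)
    qed
    moreover have "(\<lambda>n. G n \<xi>) \<longlonglongrightarrow> max 0 (min 1 (v \<xi>))"
      unfolding G_def by (intro tendsto_intros glim \<xi>)
    moreover have "max 0 (min 1 (v \<xi>)) = v \<xi>" by (simp add: v_def)
    ultimately show ?thesis unfolding u_def arg using tendsto_mult by fastforce
  qed
  have ucm: "(\<lambda>\<xi>. u n (cis \<xi>)) \<in> borel_measurable borel" for n
    by (intro borel_measurable_continuous_onI continuous_on_compose2[OF uc] continuous_intros) auto
  have "AE \<xi> in lebesgue. \<xi> \<notin> N" using N by (simp add: AE_not_in negligible_iff_null_sets)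
  then have Nb: "AE \<xi> in lborel. \<xi> \<notin> N" by (simp add: AE_completion_iff)
  have "(\<lambda>n. LINT \<xi>|lborel. u n (cis \<xi>) * W \<xi>) \<longlonglongrightarrow> (LINT \<xi>|lborel. v \<xi> * W \<xi>)"
  proof (rule integral_dominated_convergence[where w="\<lambda>\<xi>. \<bar>W \<xi>\<bar>"])
    show "integrable lborel (\<lambda>\<xi>. \<bar>W \<xi>\<bar>)" using W by simp
    show "AE \<xi> in lborel. (\<lambda>n. u n (cis \<xi>) * W \<xi>) \<longlonglongrightarrow> v \<xi> * W \<xi>"
      using Nb
    proof eventually_elim
      case (elim \<xi>)
      show ?case
      proof (cases "\<xi> \<in> {0<..<2*pi}")
        case True
        then show ?thesis by (intro tendsto_intros ulim elim)
      qed (simp add: supp)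
    qed
    show "AE \<xi> in lborel. norm (u n (cis \<xi>) * W \<xi>) \<le> \<bar>W \<xi>\<bar>" for n
      using ub by (intro AE_I2) (simp add: abs_mult mult_left_le_one_le)
    show "(\<lambda>\<xi>. u n (cis \<xi>) * W \<xi>) \<in> borel_measurable lborel" for n using ucm[of n] by measurable
  qed measurable
  moreover have "0 \<le> (LINT \<xi>|lborel. u n (cis \<xi>) * W \<xi>)" for n
    by (rule integral_circle_continuous_nonneg[OF W pos uc]) (use ub in auto)
  ultimately have ge: "0 \<le> (LINT \<xi>|lborel. v \<xi> * W \<xi>)" by (intro LIMSEQ_le_const) auto
  have neg: "- (v \<xi> * W \<xi>) \<ge> 0" for \<xi> by (simp add: v_def)
  have vW: "integrable lborel (\<lambda>\<xi>. - (v \<xi> * W \<xi>))"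
    by (rule Bochner_Integration.integrable_bound[OF W]) (auto simp: v_def)
  have "0 \<le> (LINT \<xi>|lborel. - (v \<xi> * W \<xi>))"
    by (intro Bochner_Integration.integral_nonneg neg)
  then have "(LINT \<xi>|lborel. - (v \<xi> * W \<xi>)) = 0"
    using ge by simp
  then have "AE \<xi> in lborel. - (v \<xi> * W \<xi>) = 0"
    using integral_nonneg_eq_0_iff_AE[OF vW] neg by simp
  then show ?thesis by eventually_elim (auto simp: v_def split: if_splits)
qed

section \<open>Riesz bounds and the periodized power spectrum\<close>

lemma AE_lebesgue_affine:
  fixes P :: "real \<Rightarrow> bool"
  assumes "AE x in lebesgue. P x" "c \<noteq> 0"
  shows "AE x in lebesgue. P (t + c * x)"
proof -
  have "AE x in lborel. P x" using assms(1) by (simp add: AE_completion_iff)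
  then obtain N where N: "\<And>x. x \<in> space lborel - N \<Longrightarrow> P x" "N \<in> null_sets lborel"
    by (rule AE_E3) blast
  have [measurable]: "N \<in> sets borel" using N(2) by auto
  have "AE x in lborel. x \<notin> N" using N(2) by (rule AE_not_in)
  then have "AE x in lborel. t + c * x \<notin> N"
    using assms(2) by (intro AE_borel_affine[where P="\<lambda>x. x \<notin> N"]) auto
  then have "AE x in lborel. P (t + c * x)"
    by eventually_elim (use N(1) in auto)
  then show ?thesis by (simp add: AE_completion_iff)
qed

text \<open>
The substitution \<open>\<xi> = (\<omega> - p) / B\<close> preserves null sets and carries the segment to the interval
\<open>[- p / B, 2\<pi> - p / B]\<close>, for either sign of \<open>B\<close>. Every point has a translate by a multiple of \<open>2\<pi>\<close> in this
interval, and countably many translates of a null set form a null set.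
\<close>

lemma AE_periodic_iff_AE_on_period:
  fixes Q :: "real \<Rightarrow> bool"
  assumes B: "B \<noteq> 0" and per: "\<And>\<xi> k. Q (\<xi> + 2 * of_int k * pi) = Q \<xi>"
  shows "(AE \<omega> in lebesgue. \<omega> \<in> closed_segment 0 (2 * pi * B) \<longrightarrow> Q ((\<omega> - p) / B)) \<longleftrightarrow> (AE \<xi> in lebesgue. Q \<xi>)"
proof
  assume "AE \<xi> in lebesgue. Q \<xi>"
  from AE_lebesgue_affine[OF this, of "1 / B" "- p / B"]
  have "AE \<omega> in lebesgue. Q (- p / B + 1 / B * \<omega>)" using B by simp
  then show "AE \<omega> in lebesgue. \<omega> \<in> closed_segment 0 (2 * pi * B) \<longrightarrow> Q ((\<omega> - p) / B)"
    by eventually_elim (simp add: diff_divide_distrib)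
next
  assume "AE \<omega> in lebesgue. \<omega> \<in> closed_segment 0 (2 * pi * B) \<longrightarrow> Q ((\<omega> - p) / B)"
  from AE_lebesgue_affine[OF this B, of p]
  have 1: "AE \<xi> in lebesgue. p + B * \<xi> \<in> closed_segment 0 (2 * pi * B) \<longrightarrow> Q \<xi>"
    using B by simp
  have "AE \<xi> in lebesgue. p + B * (\<xi> + 2 * of_int k * pi) \<in> closed_segment 0 (2 * pi * B) \<longrightarrow> Q \<xi>" for k
    using AE_lebesgue_affine[OF 1, of 1 "2 * of_int k * pi"] by (simp add: add.commute[of _ "_ :: real"] per)
  then have "AE \<xi> in lebesgue. \<forall>k::int. p + B * (\<xi> + 2 * of_int k * pi) \<in> closed_segment 0 (2 * pi * B) \<longrightarrow> Q \<xi>"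
    by (simp only: AE_all_countable) blast
  then show "AE \<xi> in lebesgue. Q \<xi>"
  proof eventually_elim
    case (elim \<xi>)
    \<comment> \<open>With \<open>y\<close> measuring the position in units of the period, \<open>frac y\<close> is the segment parameter of the translate.\<close>
    define y where "y = (\<xi> + p / B) / (2 * pi)"
    have "p + B * (\<xi> + 2 * of_int (- \<lfloor>y\<rfloor>) * pi) = (1 - frac y) *\<^sub>R 0 + frac y *\<^sub>R (2 * pi * B)"
      using B by (simp add: y_def frac_def field_simps)
    then have "p + B * (\<xi> + 2 * of_int (- \<lfloor>y\<rfloor>) * pi) \<in> closed_segment 0 (2 * pi * B)"
      unfolding closed_segment_def using frac_ge_0[of y] frac_lt_1[of y] by (auto intro!: exI[of _ "frac y"])
    with elim show ?case by blast
  qed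
qed

lemma AE_periodization_cong:
  assumes "AE \<xi> in lebesgue. g \<xi> = g' \<xi>"
  shows "AE \<xi> in lebesgue. periodization g \<xi> = periodization g' \<xi>"
proof -
  have "AE \<xi> in lebesgue. g (\<xi> + 2 * of_int k * pi) = g' (\<xi> + 2 * of_int k * pi)" for k :: int
    using AE_lebesgue_affine[OF assms, of 1 "2 * of_int k * pi"] by (simp add: add.commute)
  then have "AE \<xi> in lebesgue. \<forall>k::int. g (\<xi> + 2 * of_int k * pi) = g' (\<xi> + 2 * of_int k * pi)"
    by (simp only: AE_all_countable) blast
  then show ?thesis by eventually_elim (simp add: periodization_def)
qed

lemma nn_integral_trig_poly_periodization:
  assumes f: "f \<in> L2" and g: "g \<in> borel_measurable borel" "AE \<xi> in lebesgue. fourier_L2 f \<xi> = g \<xi>"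
  shows "(\<integral>\<^sup>+\<xi>. ennreal ((cmod (trig_poly d F \<xi>))\<^sup>2) * periodization g \<xi> * indicator {0..<2*pi} \<xi> \<partial>lborel)
    = ennreal (2 * pi * (L2_norm (shift_sum d F f))\<^sup>2)"
proof -
  note [measurable] = g(1)
  have "(\<integral>\<^sup>+\<xi>. ennreal ((cmod (trig_poly d F \<xi>))\<^sup>2) * periodization g \<xi> * indicator {0..<2*pi} \<xi> \<partial>lborel)
    = (\<integral>\<^sup>+\<xi>. ennreal ((cmod (trig_poly d F \<xi>))\<^sup>2) * ennreal ((cmod (g \<xi>))\<^sup>2) \<partial>lborel)"
    by (rule nn_integral_periodization[symmetric]) (simp_all add: trig_poly_periodic)
  also have "\<dots> = (\<integral>\<^sup>+\<xi>. ennreal ((cmod (trig_poly d F \<xi>))\<^sup>2) * ennreal ((cmod (g \<xi>))\<^sup>2) \<partial>lebesgue)"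
    by (simp only: nn_integral_completion)
  also have "\<dots> = (\<integral>\<^sup>+\<xi>. ennreal ((cmod (trig_poly d F \<xi> * fourier_L2 f \<xi>))\<^sup>2) \<partial>lebesgue)"
    by (intro nn_integral_cong_AE, use g(2) in eventually_elim) (simp add: norm_mult power_mult_distrib ennreal_mult)
  also have "\<dots> = ennreal ((sqrt (2 * pi) * L2_norm (shift_sum d F f))\<^sup>2)"
    unfolding L2_norm_shift_sum[OF f, symmetric]
    by (intro L2_nn_integral trig_poly_mult_L2 fourier_L2 f)
  finally show ?thesis by (simp add: power_mult_distrib)
qed

lemma AE_on_period_imp_AE:
  fixes Q :: "real \<Rightarrow> bool"
  assumes per: "\<And>\<xi> k. Q (\<xi> + 2 * of_int k * pi) = Q \<xi>" and "AE \<xi> in lborel. \<xi> \<in> {0<..<2*pi} \<longrightarrow> Q \<xi>"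
  shows "AE \<xi> in lebesgue. Q \<xi>"
proof -
  have "AE \<xi> in lborel. \<xi> \<in> closed_segment 0 (2 * pi * 1) \<longrightarrow> Q ((\<xi> - 0) / 1)"
    using assms(2) AE_lborel_singleton[of 0] AE_lborel_singleton[of "2 * pi"]
    by eventually_elim (auto simp: closed_segment_eq_real_ivl)
  then show ?thesis
    using AE_periodic_iff_AE_on_period[of 1 Q 0, OF _ per] by (simp add: AE_completion_iff)
qed

text \<open>
The norms of the finite sums of translates and of their coefficients are the integrals of \<open>\<bar>P\<bar>\<^sup>2 G\<close> and
\<open>\<bar>P\<bar>\<^sup>2\<close> over a period, where \<open>G\<close> is the periodization and \<open>P\<close> the trigonometric polynomial. From left to
right the positivity criterion is applied to \<open>G - a\<close> and \<open>b - G\<close>.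
\<close>

theorem shift_sum_bounds_iff_periodization_bounds:
  assumes f: "f \<in> L2" and ab: "a > 0" "b > 0"
  shows "(\<forall>F d. finite F \<longrightarrow> a * (\<Sum>k\<in>F. (cmod (d k))\<^sup>2) \<le> (L2_norm (shift_sum d F f))\<^sup>2 \<and>
        (L2_norm (shift_sum d F f))\<^sup>2 \<le> b * (\<Sum>k\<in>F. (cmod (d k))\<^sup>2))
    \<longleftrightarrow> (AE \<xi> in lebesgue. ennreal a \<le> periodization (fourier_L2 f) \<xi> \<and> periodization (fourier_L2 f) \<xi> \<le> ennreal b)"
    (is "?L \<longleftrightarrow> (AE \<xi> in lebesgue. ?R (fourier_L2 f) \<xi>)")
proof -
  obtain g :: "real \<Rightarrow> complex" where gm[measurable]: "g \<in> borel_measurable borel" and ga: "AE \<xi> in lebesgue. fourier_L2 f \<xi> = g \<xi>"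
    by (rule L2_borel_representative[OF L2_borel[OF fourier_L2(1)[OF f]]])
  let ?P = "\<lambda>d F \<xi>. (cmod (trig_poly d F \<xi>))\<^sup>2"
  let ?i = "indicator {0..<2*pi} :: real \<Rightarrow> ennreal"
  note key = nn_integral_trig_poly_periodization[OF f gm ga]
  have R: "(AE \<xi> in lebesgue. ?R (fourier_L2 f) \<xi>) \<longleftrightarrow> (AE \<xi> in lebesgue. ?R g \<xi>)"
  proof
    assume "AE \<xi> in lebesgue. ?R (fourier_L2 f) \<xi>"
    with AE_periodization_cong[OF ga] show "AE \<xi> in lebesgue. ?R g \<xi>" by eventually_elim simp
  next
    assume "AE \<xi> in lebesgue. ?R g \<xi>"
    with AE_periodization_cong[OF ga] show "AE \<xi> in lebesgue. ?R (fourier_L2 f) \<xi>" by eventually_elim simp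
  qed
  have "?L \<longleftrightarrow> (AE \<xi> in lebesgue. ?R g \<xi>)"
  proof
    assume "AE \<xi> in lebesgue. ?R g \<xi>"
    then have AE: "AE \<xi> in lborel. ?R g \<xi>" by (simp add: AE_completion_iff)
    show ?L
    proof (intro allI impI)
      fix F :: "int set" and d assume F: "finite F"
      let ?s = "\<Sum>k\<in>F. (cmod (d k))\<^sup>2" and ?n = "(L2_norm (shift_sum d F f))\<^sup>2"
      have s: "?s \<ge> 0" by (intro sum_nonneg) simp
      have c: "(\<integral>\<^sup>+\<xi>. ennreal c * (ennreal (?P d F \<xi>) * ?i \<xi>) \<partial>lborel) = ennreal (2 * pi * (c * ?s))" if "c > 0" for c
      proof -
        have "(\<integral>\<^sup>+\<xi>. ennreal c * (ennreal (?P d F \<xi>) * ?i \<xi>) \<partial>lborel) = ennreal c * ennreal (2 * pi * ?s)"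
          unfolding trig_poly_parseval[OF F, symmetric] by (rule nn_integral_cmult) measurable
        then show ?thesis using that s by (simp add: ennreal_mult[symmetric] mult_ac)
      qed
      have "ennreal (2 * pi * (a * ?s)) \<le> ennreal (2 * pi * ?n)"
        unfolding c[OF ab(1), symmetric] key[symmetric]
        by (intro nn_integral_mono_AE, use AE in eventually_elim)
          (auto simp: indicator_def mult.commute[of "ennreal a"] intro: mult_left_mono)
      moreover have "ennreal (2 * pi * ?n) \<le> ennreal (2 * pi * (b * ?s))"
        unfolding c[OF ab(2), symmetric] key[symmetric]
        by (intro nn_integral_mono_AE, use AE in eventually_elim)
          (auto simp: indicator_def mult.commute[of "ennreal b"] intro: mult_left_mono)
      ultimately have "2 * pi * (a * ?s) \<le> 2 * pi * ?n" "2 * pi * ?n \<le> 2 * pi * (b * ?s)"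
        using ab s by (auto simp: ennreal_le_iff)
      then show "a * ?s \<le> ?n \<and> ?n \<le> b * ?s" by simp
    qed
  next
    assume L: ?L
    have [measurable]: "periodization g \<in> borel_measurable borel" by measurable
    \<comment> \<open>\<open>G\<close> has values in the extended reals; the trivial polynomial \<open>P = 1\<close> shows that it is finite almost everywhere on the period.\<close>
    define w where "w \<xi> = enn2real (periodization g \<xi> * indicator {0<..<2*pi} \<xi>)" for \<xi>
    define J where "J \<xi> = (indicator {0<..<2*pi} \<xi> :: real)" for \<xi> :: real
    have [measurable]: "w \<in> borel_measurable borel" unfolding w_def by measurable
    have [measurable]: "J \<in> borel_measurable borel" unfolding J_def[abs_def] by measurable
    have ae0: "AE \<xi> in lborel. \<xi> \<noteq> (0::real)" by (rule AE_lborel_singleton)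
    have P1: "?P (\<lambda>k. 1) {0} \<xi> = 1" for \<xi> by (simp add: trig_poly_def)
    have "AE \<xi> in lborel. periodization g \<xi> * ?i \<xi> \<noteq> \<infinity>"
      using key[of "\<lambda>k. 1" "{0}"] by (intro nn_integral_PInf_AE) (simp_all add: P1 trig_poly_def)
    then have fin: "AE \<xi> in lborel. periodization g \<xi> * indicator {0<..<2*pi} \<xi> = ennreal (w \<xi>)"
      unfolding w_def by eventually_elim (auto simp: indicator_def less_top split: if_splits)
    have wint: "has_bochner_integral lborel (\<lambda>\<xi>. ?P d F \<xi> * w \<xi>) (2 * pi * (L2_norm (shift_sum d F f))\<^sup>2)" for d F
    proof (rule has_bochner_integral_nn_integral)
      show "(\<integral>\<^sup>+\<xi>. ennreal (?P d F \<xi> * w \<xi>) \<partial>lborel) = ennreal (2 * pi * (L2_norm (shift_sum d F f))\<^sup>2)"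
        unfolding key[symmetric]
      proof (intro nn_integral_cong_AE, use fin ae0 in eventually_elim)
        case (elim \<xi>)
        then show ?case
          by (simp add: ennreal_mult w_def mult.assoc flip: elim(1)) (simp add: indicator_def)
      qed
    qed (auto simp: w_def)
    have Jint: "has_bochner_integral lborel (\<lambda>\<xi>. ?P d F \<xi> * J \<xi>) (2 * pi * (\<Sum>k\<in>F. (cmod (d k))\<^sup>2))" if "finite F" for d F
    proof (rule has_bochner_integral_nn_integral)
      show "(\<integral>\<^sup>+\<xi>. ennreal (?P d F \<xi> * J \<xi>) \<partial>lborel) = ennreal (2 * pi * (\<Sum>k\<in>F. (cmod (d k))\<^sup>2))"
        unfolding trig_poly_parseval[OF that, symmetric]
        by (intro nn_integral_cong_AE, use ae0 in eventually_elim) (simp add: J_def indicator_def)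
    qed (auto simp: J_def sum_nonneg)
    have wi: "integrable lborel w" and Ji: "integrable lborel J"
      using wint[of "\<lambda>k. 1" "{0}"] Jint[of "{0}" "\<lambda>k. 1"]
      unfolding P1 by (auto simp: has_bochner_integral_iff)
    have lin: "(LINT \<xi>|lborel. ?P d F \<xi> * (x * w \<xi> + y * J \<xi>))
        = 2 * pi * (x * (L2_norm (shift_sum d F f))\<^sup>2 + y * (\<Sum>k\<in>F. (cmod (d k))\<^sup>2))" if "finite F" for d F and x y :: real
    proof -
      have "has_bochner_integral lborel (\<lambda>\<xi>. x * (?P d F \<xi> * w \<xi>) + y * (?P d F \<xi> * J \<xi>))
         (x * (2 * pi * (L2_norm (shift_sum d F f))\<^sup>2) + y * (2 * pi * (\<Sum>k\<in>F. (cmod (d k))\<^sup>2)))"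
        by (intro has_bochner_integral_add has_bochner_integral_mult_right wint Jint that)
      then show ?thesis
        by (subst has_bochner_integral_integral_eq[symmetric]) (auto simp: algebra_simps intro!: Bochner_Integration.integral_cong)
    qed
    have pos: "AE \<xi> in lborel. 0 \<le> x * w \<xi> + y * J \<xi>"
      if nonneg: "\<And>F d. finite F \<Longrightarrow> 0 \<le> x * (L2_norm (shift_sum d F f))\<^sup>2 + y * (\<Sum>k\<in>F. (cmod (d k))\<^sup>2)" for x y :: real
    proof (rule AE_nonneg_if_trig_poly_integrals_nonneg)
      show "integrable lborel (\<lambda>\<xi>. x * w \<xi> + y * J \<xi>)" using wi Ji by simp
      show "0 \<le> (LINT \<xi>|lborel. ?P d F \<xi> * (x * w \<xi> + y * J \<xi>))" if "finite F" for d F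
        using lin[OF that] nonneg[OF that] by simp
    qed (auto simp: w_def J_def)
    have lo: "AE \<xi> in lborel. 0 \<le> 1 * w \<xi> + (- a) * J \<xi>" by (rule pos) (use L in auto)
    have hi: "AE \<xi> in lborel. 0 \<le> (- 1) * w \<xi> + b * J \<xi>" by (rule pos) (use L in auto)
    have "AE \<xi> in lborel. \<xi> \<in> {0<..<2*pi} \<longrightarrow> ?R g \<xi>"
      using lo hi fin by eventually_elim (auto simp: J_def intro!: ennreal_leI)
    then show "AE \<xi> in lebesgue. ?R g \<xi>"
      by (rule AE_on_period_imp_AE[rotated]) (simp add: periodization_periodic)
  qed
  then show ?thesis unfolding R .
qed

text \<open>
For the closed span only the norm equivalence is at stake. It passes from finite sums to square summable
coefficients by completeness: the upper bound applied to differences of finite partial sums makes them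
Cauchy. In the other direction a finite sum is a series with finitely supported coefficients.
\<close>

theorem riesz_basis_closed_span_iff:
  fixes x :: "'i \<Rightarrow> real \<Rightarrow> complex"
  assumes x: "\<And>k. x k \<in> L2"
  shows "riesz_basis x (L2_closed_span x) \<longleftrightarrow>
    (\<exists>a b :: real. a > 0 \<and> b > 0 \<and> (\<forall>F c. finite F \<longrightarrow>
      a * (\<Sum>k\<in>F. (cmod (c k))\<^sup>2) \<le> (L2_norm (\<lambda>t. \<Sum>k\<in>F. c k * x k t))\<^sup>2 \<and>
      (L2_norm (\<lambda>t. \<Sum>k\<in>F. c k * x k t))\<^sup>2 \<le> b * (\<Sum>k\<in>F. (cmod (c k))\<^sup>2)))"
proof -
  let ?T = "\<lambda>c F t. \<Sum>k\<in>F. c k * x k t"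
  let ?fin = "\<lambda>a b c F. a * (\<Sum>k\<in>F. (cmod (c k))\<^sup>2) \<le> (L2_norm (?T c F))\<^sup>2 \<and> (L2_norm (?T c F))\<^sup>2 \<le> b * (\<Sum>k\<in>F. (cmod (c k))\<^sup>2)"
  let ?inf = "\<lambda>a b c. \<exists>f. has_L2_sum (\<lambda>k t. c k * x k t) f \<and>
      a * (\<Sum>\<^sub>\<infinity>k. (cmod (c k))\<^sup>2) \<le> (L2_norm f)\<^sup>2 \<and> (L2_norm f)\<^sup>2 \<le> b * (\<Sum>\<^sub>\<infinity>k. (cmod (c k))\<^sup>2)"
  have T2: "?T c F \<in> L2" for c :: "'i \<Rightarrow> complex" and F by (intro L2_sum L2_cmult x)
  have "(\<forall>c. (\<lambda>k. (cmod (c k))\<^sup>2) summable_on UNIV \<longrightarrow> ?inf a b c) \<longleftrightarrow> (\<forall>F c. finite F \<longrightarrow> ?fin a b c F)"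
    if a: "a > 0" and b: "b > 0" for a b :: real
  proof (intro iffI allI impI)
    fix F :: "'i set" and c :: "'i \<Rightarrow> complex"
    assume inf: "\<forall>c. (\<lambda>k. (cmod (c k))\<^sup>2) summable_on UNIV \<longrightarrow> ?inf a b c" and F: "finite F"
    define c' where "c' k = (if k \<in> F then c k else 0)" for k
    have hs: "((\<lambda>k. (cmod (c' k))\<^sup>2) has_sum (\<Sum>k\<in>F. (cmod (c k))\<^sup>2)) UNIV"
      by (rule has_sum_finite_neutralI[OF F]) (auto simp: c'_def)
    then obtain f where f: "has_L2_sum (\<lambda>k t. c' k * x k t) f"
        "a * (\<Sum>k\<in>F. (cmod (c k))\<^sup>2) \<le> (L2_norm f)\<^sup>2" "(L2_norm f)\<^sup>2 \<le> b * (\<Sum>k\<in>F. (cmod (c k))\<^sup>2)"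
      using inf[rule_format, OF has_sum_imp_summable[OF hs]] unfolding infsumI[OF hs] by blast
    \<comment> \<open>The partial sums of the extended series are eventually equal to the finite sum.\<close>
    have "\<forall>\<^sub>F E in finite_subsets_at_top UNIV. L2_norm (\<lambda>t. ?T c' E t - f t) = L2_norm (\<lambda>t. ?T c F t - f t)"
    proof (unfold eventually_finite_subsets_at_top, intro exI[of _ F] conjI allI impI)
      fix E assume E: "finite E \<and> F \<subseteq> E \<and> E \<subseteq> UNIV"
      have "?T c' E t = ?T c F t" for t
        using E F by (intro sum.mono_neutral_cong_right) (auto simp: c'_def)
      then show "L2_norm (\<lambda>t. ?T c' E t - f t) = L2_norm (\<lambda>t. ?T c F t - f t)" by simp
    qed (use F in auto)
    moreover have "((\<lambda>E. L2_norm (\<lambda>t. ?T c' E t - f t)) \<longlongrightarrow> 0) (finite_subsets_at_top UNIV)"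
      using f(1) by (simp add: has_L2_sum_def)
    ultimately have "((\<lambda>E::'i set. L2_norm (\<lambda>t. ?T c F t - f t)) \<longlongrightarrow> 0) (finite_subsets_at_top UNIV)"
      by (rule Lim_transform_eventually[rotated])
    then have "L2_norm (\<lambda>t. ?T c F t - f t) = 0"
      by (simp add: tendsto_const_iff)
    then have "L2_norm (?T c F) = L2_norm f"
      using L2_norm_diff_ge[OF T2, of f c F] f(1) by (simp add: has_L2_sum_def)
    then show "?fin a b c F" using f by simp
  next
    fix c :: "'i \<Rightarrow> complex"
    assume fin: "\<forall>F c. finite F \<longrightarrow> ?fin a b c F" and summ: "(\<lambda>k. (cmod (c k))\<^sup>2) summable_on UNIV"
    define s where "s = (\<Sum>\<^sub>\<infinity>k. (cmod (c k))\<^sup>2)"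
    let ?q = "\<lambda>F. \<Sum>k\<in>F. (cmod (c k))\<^sup>2"
    have hs: "((\<lambda>k. (cmod (c k))\<^sup>2) has_sum s) UNIV"
      unfolding s_def using summ by (rule has_sum_infsum)
    then have qlim: "(?q \<longlongrightarrow> s) (finite_subsets_at_top UNIV)" by (simp add: has_sum_def)
    have qs: "?q F \<le> s" if "finite F" for F
      using finite_sum_le_has_sum[OF hs that] by simp
    have "\<exists>F. finite F \<and> s - ?q F < 1 / real (Suc n)" for n
      using order_tendstoD(1)[OF qlim, of "s - 1 / real (Suc n)"] unfolding eventually_finite_subsets_at_top
      by (auto simp: algebra_simps)
    then obtain E where E: "finite (E n)" "s - ?q (E n) < 1 / real (Suc n)" for n by metis
    \<comment> \<open>The finite sets \<open>E n\<close> exhaust the squared norm of \<open>c\<close> up to \<open>1 / (n + 1)\<close>, so \<open>\<delta> n\<close> bounds what lies outside.\<close>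
    define \<delta> where "\<delta> n = sqrt (b * (1 / real (Suc n)))" for n
    have close: "L2_norm (\<lambda>t. ?T c F t - ?T c (E n) t) \<le> \<delta> n" if "finite F" "E n \<subseteq> F" for F n
    proof -
      have "(\<lambda>t. ?T c F t - ?T c (E n) t) = ?T c (F - E n)"
        using that by (auto simp: sum_diff)
      then have "(L2_norm (\<lambda>t. ?T c F t - ?T c (E n) t))\<^sup>2 \<le> b * ?q (F - E n)"
        using fin that by simp
      also have "?q (F - E n) = ?q F - ?q (E n)" using that by (simp add: sum_diff)
      also have "b * (?q F - ?q (E n)) \<le> b * (1 / real (Suc n))"
        using qs[OF that(1)] E(2)[of n] b by (intro mult_left_mono) auto
      finally show ?thesis unfolding \<delta>_def by (rule real_le_rsqrt)
    qed
    have \<delta>lim: "\<delta> \<longlonglongrightarrow> 0"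
      unfolding \<delta>_def using tendsto_real_sqrt[OF tendsto_mult_right_zero[OF LIMSEQ_Suc[OF lim_1_over_n], of b]] by simp
    have dec: "\<delta> n \<le> \<delta> N" if "N \<le> n" for n N
      unfolding \<delta>_def using that b by (intro real_sqrt_le_mono mult_left_mono frac_le) auto
    have C: "\<exists>N. \<forall>m\<ge>N. \<forall>n\<ge>N. L2_norm (\<lambda>t. ?T c (E m) t - ?T c (E n) t) < e" if e: "e > 0" for e
    proof -
      obtain N where N: "\<delta> N < e / 2"
        using order_tendstoD(2)[OF \<delta>lim, of "e / 2"] e by (auto simp: eventually_sequentially)
      have "L2_norm (\<lambda>t. ?T c (E m) t - ?T c (E n) t) < e" if "m \<ge> N" "n \<ge> N" for m n
      proof -
        let ?U = "E m \<union> E n"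
        have "L2_norm (\<lambda>t. ?T c (E m) t - ?T c (E n) t)
          \<le> L2_norm (\<lambda>t. ?T c (E m) t - ?T c ?U t) + L2_norm (\<lambda>t. ?T c ?U t - ?T c (E n) t)"
          by (rule L2_norm_triangle_diff[OF T2 T2 T2])
        also have "L2_norm (\<lambda>t. ?T c (E m) t - ?T c ?U t) = L2_norm (\<lambda>t. ?T c ?U t - ?T c (E m) t)"
          by (rule L2_norm_minus_commute)
        also have "\<dots> \<le> \<delta> m" by (rule close) (use E in auto)
        also have "L2_norm (\<lambda>t. ?T c ?U t - ?T c (E n) t) \<le> \<delta> n" by (rule close) (use E in auto)
        finally show ?thesis using dec[OF that(1)] dec[OF that(2)] N by simp
      qed
      then show ?thesis by blast
    qed
    obtain f where f: "f \<in> L2" "(\<lambda>n. L2_norm (\<lambda>t. ?T c (E n) t - f t)) \<longlonglongrightarrow> 0"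
      by (rule L2_complete[OF T2 C])
    have lim: "((\<lambda>F. L2_norm (\<lambda>t. ?T c F t - f t)) \<longlongrightarrow> 0) (finite_subsets_at_top UNIV)"
    proof (rule order_tendstoI)
      fix e :: real assume e: "0 < e"
      have "\<forall>\<^sub>F n in sequentially. \<delta> n < e / 2 \<and> L2_norm (\<lambda>t. ?T c (E n) t - f t) < e / 2"
        using order_tendstoD(2)[OF \<delta>lim, of "e / 2"] order_tendstoD(2)[OF f(2), of "e / 2"] e
        by (auto intro: eventually_conj)
      then obtain n where n: "\<delta> n < e / 2" "L2_norm (\<lambda>t. ?T c (E n) t - f t) < e / 2"
        by (auto simp: eventually_sequentially)
      show "\<forall>\<^sub>F F in finite_subsets_at_top UNIV. L2_norm (\<lambda>t. ?T c F t - f t) < e"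
      proof (unfold eventually_finite_subsets_at_top, intro exI[of _ "E n"] conjI allI impI)
        fix F assume "finite F \<and> E n \<subseteq> F \<and> F \<subseteq> UNIV"
        then have "L2_norm (\<lambda>t. ?T c F t - ?T c (E n) t) \<le> \<delta> n" by (intro close) auto
        then show "L2_norm (\<lambda>t. ?T c F t - f t) < e"
          using L2_norm_triangle_diff[OF T2[of c F] T2[of c "E n"] f(1)] n by linarith
      qed (use E in auto)
    next
      fix e :: real assume "e < 0"
      then show "\<forall>\<^sub>F F in finite_subsets_at_top UNIV. e < L2_norm (\<lambda>t. ?T c F t - f t)"
        by (intro always_eventually allI) (rule less_le_trans[OF _ L2_norm_nonneg])
    qed
    have nlim: "((\<lambda>F. (L2_norm (?T c F))\<^sup>2) \<longlongrightarrow> (L2_norm f)\<^sup>2) (finite_subsets_at_top UNIV)"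
      by (intro tendsto_power L2_norm_tendsto[OF f(1) T2 lim])
    have "a * s \<le> (L2_norm f)\<^sup>2"
      by (rule tendsto_le[OF _ nlim tendsto_mult_left[OF qlim]])
        (use fin in \<open>auto intro!: eventually_finite_subsets_at_top_weakI\<close>)
    moreover have "(L2_norm f)\<^sup>2 \<le> b * s"
      by (rule tendsto_le[OF _ tendsto_mult_left[OF qlim] nlim])
        (use fin in \<open>auto intro!: eventually_finite_subsets_at_top_weakI\<close>)
    moreover have "has_L2_sum (\<lambda>k t. c k * x k t) f"
      using f(1) lim by (simp add: has_L2_sum_def)
    ultimately show "?inf a b c" unfolding s_def by blast
  qed
  then show ?thesis unfolding riesz_basis_def using x by (simp cong: conj_cong)
qed

section \<open>The chirped translates\<close>

definition chirp :: "real \<Rightarrow> real \<Rightarrow> real \<Rightarrow> real \<Rightarrow> real \<Rightarrow> complex" where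
  "chirp A B D p t = exp (- \<i> * complex_of_real ((A * t\<^sup>2 + D * p\<^sup>2) / (2 * B)))"

text \<open>
The double sign puts this factor into the same form \<open>exp(-ir)\<close> with real \<open>r\<close> as the chirp, so that both have
modulus one for the same reason.
\<close>

definition unit_factor :: "real \<Rightarrow> real \<Rightarrow> int \<Rightarrow> complex" where
  "unit_factor A B k = exp (- \<i> * complex_of_real (- (A * (of_int k)\<^sup>2) / (2 * B)))"

lemma norm_chirp [simp]: "cmod (chirp A B D p t) = 1" and norm_unit_factor [simp]: "cmod (unit_factor A B k) = 1"
  unfolding chirp_def unit_factor_def by (rule norm_exp_ii)+

lemma phi_M_eq: "phi_M A B C D p q \<phi> k t = chirp A B D p t * (unit_factor A B k * \<phi> (t - of_int k))"
proof -
  have "exp (- (\<i> / complex_of_real (2 * B)) * complex_of_real (A * t\<^sup>2 + D * p\<^sup>2 - A * (of_int k)\<^sup>2))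
      = chirp A B D p t * unit_factor A B k"
    unfolding chirp_def unit_factor_def exp_add[symmetric]
    by (rule arg_cong[of _ _ exp]) (simp add: diff_divide_distrib add_divide_distrib algebra_simps)
  then show ?thesis by (simp add: phi_M_def)
qed

lemma phi_M_sum: "(\<Sum>k\<in>F. c k * phi_M A B C D p q \<phi> k t) = chirp A B D p t * shift_sum (\<lambda>k. c k * unit_factor A B k) F \<phi> t"
  by (simp add: phi_M_eq shift_sum_def sum_distrib_left mult_ac)

lemma phi_M_L2:
  assumes "\<phi> \<in> L2" shows "phi_M A B C D p q \<phi> k \<in> L2"
proof -
  have "chirp A B D p \<in> borel_measurable lborel"
    unfolding chirp_def[abs_def] by measurable
  then have c: "chirp A B D p \<in> borel_measurable lebesgue" by (rule measurable_completion)
  have s: "(\<lambda>t. unit_factor A B k * \<phi> (t - of_int k)) \<in> L2" by (intro L2_cmult L2_shift(1) assms)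
  have "(\<lambda>t. chirp A B D p t * (unit_factor A B k * \<phi> (t - of_int k))) \<in> L2"
    by (rule L2_dominated[OF s, where M=1]) (use c L2_borel[OF s] in \<open>auto simp: norm_mult intro!: borel_measurable_times\<close>)
  then show ?thesis by (simp add: phi_M_eq[abs_def])
qed

lemma L2_norm_phi_M_sum:
  "L2_norm (\<lambda>t. \<Sum>k\<in>F. c k * phi_M A B C D p q \<phi> k t) = L2_norm (shift_sum (\<lambda>k. c k * unit_factor A B k) F \<phi>)"
  by (simp add: phi_M_sum L2_norm_def norm_mult)

lemma phi_M_bounds_iff:
  fixes a b :: real
  shows "(\<forall>F c. finite F \<longrightarrow> a * (\<Sum>k\<in>F. (cmod (c k))\<^sup>2) \<le> (L2_norm (\<lambda>t. \<Sum>k\<in>F. c k * phi_M A B C D p q \<phi> k t))\<^sup>2 \<and>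
        (L2_norm (\<lambda>t. \<Sum>k\<in>F. c k * phi_M A B C D p q \<phi> k t))\<^sup>2 \<le> b * (\<Sum>k\<in>F. (cmod (c k))\<^sup>2))
    \<longleftrightarrow> (\<forall>F d. finite F \<longrightarrow> a * (\<Sum>k\<in>F. (cmod (d k))\<^sup>2) \<le> (L2_norm (shift_sum d F \<phi>))\<^sup>2 \<and>
        (L2_norm (shift_sum d F \<phi>))\<^sup>2 \<le> b * (\<Sum>k\<in>F. (cmod (d k))\<^sup>2))" (is "?L \<longleftrightarrow> ?R")
proof
  assume ?L
  show ?R
  proof (intro allI impI)
    fix F :: "int set" and d assume "finite F"
    have "unit_factor A B k \<noteq> 0" for k using norm_unit_factor[of A B k] by fastforce
    then have "(\<lambda>k. d k / unit_factor A B k * unit_factor A B k) = d" by simp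
    moreover have "cmod (d k / unit_factor A B k) = cmod (d k)" for k by (simp add: norm_divide)
    ultimately show "a * (\<Sum>k\<in>F. (cmod (d k))\<^sup>2) \<le> (L2_norm (shift_sum d F \<phi>))\<^sup>2 \<and>
        (L2_norm (shift_sum d F \<phi>))\<^sup>2 \<le> b * (\<Sum>k\<in>F. (cmod (d k))\<^sup>2)"
      using \<open>?L\<close>[rule_format, OF \<open>finite F\<close>, of "\<lambda>k. d k / unit_factor A B k"] unfolding L2_norm_phi_M_sum by simp
  qed
next
  assume R: ?R
  show ?L
  proof (intro allI impI)
    fix F :: "int set" and c :: "int \<Rightarrow> complex" assume "finite F"
    from R[rule_format, OF this, of "\<lambda>k. c k * unit_factor A B k"]
    show "a * (\<Sum>k\<in>F. (cmod (c k))\<^sup>2) \<le> (L2_norm (\<lambda>t. \<Sum>k\<in>F. c k * phi_M A B C D p q \<phi> k t))\<^sup>2 \<and>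
        (L2_norm (\<lambda>t. \<Sum>k\<in>F. c k * phi_M A B C D p q \<phi> k t))\<^sup>2 \<le> b * (\<Sum>k\<in>F. (cmod (c k))\<^sup>2)"
      unfolding L2_norm_phi_M_sum by (simp add: norm_mult)
  qed
qed

theorem theorem4p2:
  fixes A B C D p q :: real and \<phi> :: "real \<Rightarrow> complex" and V\<^sub>0 :: "(real \<Rightarrow> complex) set"
  assumes "A * D - B * C = 1" and "B \<noteq> 0"
    and "\<phi> \<in> L2"
    and "V\<^sub>0 = L2_closed_span (phi_M A B C D p q \<phi>)"
  shows "riesz_basis (phi_M A B C D p q \<phi>) V\<^sub>0 \<longleftrightarrow>
    (\<exists>A\<^sub>1 A\<^sub>2 :: real. A\<^sub>1 > 0 \<and> A\<^sub>2 > 0 \<and>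
      (AE \<omega> in lebesgue. \<omega> \<in> closed_segment 0 (2 * pi * B) \<longrightarrow>
        ennreal A\<^sub>1 \<le> (\<Sum>\<^sub>\<infinity>k::int. ennreal ((cmod (fourier_L2 \<phi> ((\<omega> - p) / B + 2 * of_int k * pi)))\<^sup>2)) \<and>
        (\<Sum>\<^sub>\<infinity>k::int. ennreal ((cmod (fourier_L2 \<phi> ((\<omega> - p) / B + 2 * of_int k * pi)))\<^sup>2)) \<le> ennreal A\<^sub>2))"
proof -
  let ?G = "periodization (fourier_L2 \<phi>)"
  have "riesz_basis (phi_M A B C D p q \<phi>) V\<^sub>0 \<longleftrightarrow>
      (\<exists>a b :: real. a > 0 \<and> b > 0 \<and> (AE \<xi> in lebesgue. ennreal a \<le> ?G \<xi> \<and> ?G \<xi> \<le> ennreal b))"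
    unfolding assms(4) riesz_basis_closed_span_iff[OF phi_M_L2[OF assms(3)]] phi_M_bounds_iff
    by (simp only: shift_sum_bounds_iff_periodization_bounds[OF assms(3)] cong: conj_cong)
  also have "\<dots> \<longleftrightarrow> (\<exists>a b :: real. a > 0 \<and> b > 0 \<and> (AE \<omega> in lebesgue. \<omega> \<in> closed_segment 0 (2 * pi * B) \<longrightarrow>
      ennreal a \<le> ?G ((\<omega> - p) / B) \<and> ?G ((\<omega> - p) / B) \<le> ennreal b))"
  proof -
    have "(AE \<omega> in lebesgue. \<omega> \<in> closed_segment 0 (2 * pi * B) \<longrightarrow>
        ennreal a \<le> ?G ((\<omega> - p) / B) \<and> ?G ((\<omega> - p) / B) \<le> ennreal b)
      \<longleftrightarrow> (AE \<xi> in lebesgue. ennreal a \<le> ?G \<xi> \<and> ?G \<xi> \<le> ennreal b)" for a b :: real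
      by (rule AE_periodic_iff_AE_on_period[OF assms(2), of "\<lambda>\<xi>. ennreal a \<le> ?G \<xi> \<and> ?G \<xi> \<le> ennreal b"])
        (simp only: periodization_periodic)
    then show ?thesis by (simp only:)
  qed
  finally show ?thesis unfolding periodization_def .
qed

end
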